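(* Let $d\ge 2$, $D=\{1,\dots,d\}$, and let $\lambda=\lambda_1\otimes\cdots\otimes\lambda_d$ be a product of finite, positive, nonzero measures on the product space $\Omega=\Omega_1\times\cdots\times\Omega_d$. For any $f_\mu\in\mathcal{B}^2(\lambda)$ and any $I\subseteq D$ with $|I|\ge 2$, the $I$-th interaction part $f_{\mu,I,\mathrm{int}}$ is the unique orthogonal projection of $f_\mu$ on $\mathcal{B}^2_{I,\mathrm{int}}(\lambda)$. Furthermore, \[ \mathcal{B}^2(\lambda)=\bigoplus_{i\in D}\mathcal{B}^2_{\{i\}}(\lambda)\ \oplus\bigoplus_{I\subseteq D,\ |I|\ge 2}\mathcal{B}^2_{I,\mathrm{int}}(\lambda), \] and all spaces featuring in this direct sum are mutually orthogonal.
   Context: Bayes space. For a finite, positive, nonzero measure $\lambda$ on a measurable space $(\Omega,\mathcal{A})$, $\mathcal{M}(\lambda)$ is the set of $\sigma$-finite positive measures $\mu$ on $(\Omega,\mathcal A)$ with the same null sets as $\lambda$; $\mu$ is identified with its $\lambda$-density $f_\mu=d\mu/d\lambda$. Write $f_\mu\propto f_\nu$ if $f_\mu=c f_\nu$ ($\lambda$-a.e.) for some $c\in(0,\infty)$. The Bayes space is $\mathcal{B}(\lambda)=\mathcal{M}(\lambda)/\!\propto$; equality of elements means $\propto$. Vector space operations: $f\oplus g\propto fg$, $\alpha\odot f\propto f^{\alpha}$, $f\ominus g=f\oplus((-1)\odot g)$; the neutral element is the constant density $1$. $\mathcal{B}^2(\lambda)=\{f\in\mathcal{B}(\lambda):\int_\Omega|\ln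 f|^2d\lambda<\infty\}$ is a Hilbert space with inner product $\langle f,g\rangle_{\mathcal{B}^2(\lambda)}=\frac{1}{2\lambda(\Omega)}\int_\Omega\int_\Omega \ln\{f(\omega)/f(\omega')\}\ln\{g(\omega)/g(\omega')\}\,d\lambda(\omega)\,d\lambda(\omega')$. Product setting. For $i\in D$, $(\Omega_i,\mathcal{A}_i,\lambda_i)$ is a measurable space with a finite, positive, nonzero measure; $\Omega=\prod_{i\in D}\Omega_i$, $\mathcal A=\bigotimes_{i\in D}\mathcal A_i$, $\lambda=\bigotimes_{i\in D}\lambda_i$; $\Omega_I,\lambda_I$ are the corresponding products over $i\in I$. For non-empty $I\subseteq D$, $\mathcal{B}^2_I(\lambda)$ is the subspace of those $\mu\in\mathcal{B}^2(\lambda)$ of the form $\mu_I\otimes\lambda_{D\setminus I}$ with $\mu_I\in\mathcal{B}^2(\lambda_I)$, i.e. whose $\lambda$-density depends only on the coordinates with indices in $I$ (so $\mathcal{B}^2_D(\lambda)=\mathcal{B}^2(\lambda)$). Geometric margins. For non-empty $I\subsetneq D$, $f_{\mu,I}\propto\exp\{\frac{1}{\lambda_{D\setminus I}(\Omega_{D\setminus I})}\int_{\Omega_{D\setminus I}}\ln(f_\mu)\,d\lambda_{D\setminus I}\}$; $f_{\mu,D}=f_\mu$; $f_{\mu,i}=f_{\mu,\{i\}}$. Interaction parts. For $|I|\ge2$, $f_{\mu,I,\mathrm{int}}=\bigoplus_{\varnothing\ne J\subseteq I}(-1)^{|I\setminus J|}\odot f_{\mu,J}$. Interaction spaces. Defined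 recursively on $|I|\ge 2$: $\mathcal{B}^2_{I,\mathrm{int}}(\lambda)$ is the orthogonal complement in $\mathcal{B}^2_I(\lambda)$ of $\mathcal{B}^2_{I,\oplus}(\lambda)=\bigoplus_{i\in I}\mathcal{B}^2_{\{i\}}(\lambda)\oplus\bigoplus_{J\subsetneq I,|J|\ge2}\mathcal{B}^2_{J,\mathrm{int}}(\lambda)$ (for $|I|=2$ the second family is empty). *)

theory Defs
  imports "HOL-Probability.Probability"
begin

text \<open>
  Elements of the Bayes space are handled through their real-valued \<open>\<lambda>\<close>-densities, as
  representatives of the classes modulo \<open>\<propto>\<close>: the relation \<open>bayes_eq L\<close> plays the role of equality,
  and every space below is a set of representatives that is closed under it.
\<close>

definition bayes_measures :: "'w measure \<Rightarrow> 'w measure set" where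
  "bayes_measures L = {\<mu>. sets \<mu> = sets L \<and> sigma_finite_measure \<mu> \<and> null_sets \<mu> = null_sets L}"

definition bayes :: "'w measure \<Rightarrow> ('w \<Rightarrow> real) set" where
  "bayes L = {f \<in> borel_measurable L. density L (\<lambda>x. ennreal (f x)) \<in> bayes_measures L}"

definition bayes_eq :: "'w measure \<Rightarrow> ('w \<Rightarrow> real) \<Rightarrow> ('w \<Rightarrow> real) \<Rightarrow> bool" where
  "bayes_eq L f g \<longleftrightarrow> (\<exists>c>0. AE x in L. f x = c * g x)"

text \<open>Real-valued densities suffice: they reach every measure in \<open>bayes_measures L\<close>.\<close>

lemma bayes_measures_eq_density:
  assumes "finite_measure L"
  shows "bayes_measures L = (\<lambda>f. density L (\<lambda>x. ennreal (f x))) ` bayes L"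
proof (intro set_eqI iffI)
  fix \<mu> assume mu: "\<mu> \<in> bayes_measures L"
  interpret L: finite_measure L by fact
  interpret N: sigma_finite_measure \<mu> using mu by (simp add: bayes_measures_def)
  have s: "sets \<mu> = sets L" and ac: "absolutely_continuous L \<mu>"
    using mu by (auto simp: bayes_measures_def absolutely_continuous_def)
  have fin: "AE x in L. RN_deriv L \<mu> x \<noteq> \<infinity>"
    by (rule L.RN_deriv_finite[OF N.sigma_finite_measure_axioms ac s])
  have "density L (\<lambda>x. ennreal (enn2real (RN_deriv L \<mu> x))) = density L (RN_deriv L \<mu>)"
    using fin by (intro density_cong) (auto simp: top.not_eq_extremum)
  also have "\<dots> = \<mu>" by (rule L.density_RN_deriv[OF ac s])
  finally have d: "density L (\<lambda>x. ennreal (enn2real (RN_deriv L \<mu> x))) = \<mu>" .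
  then have "(\<lambda>x. enn2real (RN_deriv L \<mu> x)) \<in> bayes L"
    using mu by (simp add: bayes_def)
  then show "\<mu> \<in> (\<lambda>f. density L (\<lambda>x. ennreal (f x))) ` bayes L"
    using d by (intro image_eqI[where x = "\<lambda>x. enn2real (RN_deriv L \<mu> x)"]) auto
qed (auto simp: bayes_def)

definition bayes_add :: "('w \<Rightarrow> real) \<Rightarrow> ('w \<Rightarrow> real) \<Rightarrow> 'w \<Rightarrow> real" where
  "bayes_add f g = (\<lambda>x. f x * g x)"

definition bayes_scale :: "real \<Rightarrow> ('w \<Rightarrow> real) \<Rightarrow> 'w \<Rightarrow> real" where
  "bayes_scale a f = (\<lambda>x. f x powr a)"

definition bayes_diff :: "('w \<Rightarrow> real) \<Rightarrow> ('w \<Rightarrow> real) \<Rightarrow> 'w \<Rightarrow> real" where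
  "bayes_diff f g = bayes_add f (bayes_scale (-1) g)"

text \<open>The \<open>\<oplus>\<close>-sum of a finite family; by definition of \<open>\<oplus>\<close> it is a pointwise product.\<close>

definition bayes_bigadd :: "'k set \<Rightarrow> ('k \<Rightarrow> 'w \<Rightarrow> real) \<Rightarrow> 'w \<Rightarrow> real" where
  "bayes_bigadd K w = (\<lambda>x. \<Prod>k\<in>K. w k x)"

definition B2 :: "'w measure \<Rightarrow> ('w \<Rightarrow> real) set" where
  "B2 L = {f \<in> bayes L. integrable L (\<lambda>x. \<bar>ln (f x)\<bar>\<^sup>2)}"

definition bayes_inner :: "'w measure \<Rightarrow> ('w \<Rightarrow> real) \<Rightarrow> ('w \<Rightarrow> real) \<Rightarrow> real" where
  "bayes_inner L f g =
     1 / (2 * measure L (space L)) *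
       (\<integral>y. (\<integral>x. ln (f x / f y) * ln (g x / g y) \<partial>L) \<partial>L)"

definition bayes_subspace :: "'w measure \<Rightarrow> ('w \<Rightarrow> real) set \<Rightarrow> bool" where
  "bayes_subspace L V \<longleftrightarrow>
     V \<subseteq> B2 L \<and>
     (\<forall>f\<in>V. \<forall>g\<in>bayes L. bayes_eq L g f \<longrightarrow> g \<in> V) \<and>
     (\<lambda>x. 1) \<in> V \<and>
     (\<forall>f\<in>V. \<forall>g\<in>V. bayes_add f g \<in> V) \<and>
     (\<forall>a. \<forall>f\<in>V. bayes_scale a f \<in> V)"

definition bayes_sum_space ::
    "'w measure \<Rightarrow> 'k set \<Rightarrow> ('k \<Rightarrow> ('w \<Rightarrow> real) set) \<Rightarrow> ('w \<Rightarrow> real) set" where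
  "bayes_sum_space L K W =
     {f \<in> bayes L. \<exists>w. (\<forall>k\<in>K. w k \<in> W k) \<and> bayes_eq L f (bayes_bigadd K w)}"

definition bayes_direct_sum ::
    "'w measure \<Rightarrow> ('w \<Rightarrow> real) set \<Rightarrow> 'k set \<Rightarrow> ('k \<Rightarrow> ('w \<Rightarrow> real) set) \<Rightarrow> bool" where
  "bayes_direct_sum L V K W \<longleftrightarrow>
     (\<forall>k\<in>K. bayes_subspace L (W k)) \<and>
     V = bayes_sum_space L K W \<and>
     (\<forall>w w'. (\<forall>k\<in>K. w k \<in> W k \<and> w' k \<in> W k) \<and>
        bayes_eq L (bayes_bigadd K w) (bayes_bigadd K w') \<longrightarrow>
        (\<forall>k\<in>K. bayes_eq L (w k) (w' k)))"

definition bayes_orthogonal ::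
    "'w measure \<Rightarrow> ('w \<Rightarrow> real) set \<Rightarrow> ('w \<Rightarrow> real) set \<Rightarrow> bool" where
  "bayes_orthogonal L V W \<longleftrightarrow> (\<forall>f\<in>V. \<forall>g\<in>W. bayes_inner L f g = 0)"

definition is_bayes_projection ::
    "'w measure \<Rightarrow> ('w \<Rightarrow> real) set \<Rightarrow> ('w \<Rightarrow> real) \<Rightarrow> ('w \<Rightarrow> real) \<Rightarrow> bool" where
  "is_bayes_projection L V f p \<longleftrightarrow>
     p \<in> V \<and> (\<forall>g\<in>V. bayes_inner L (bayes_diff f p) g = 0)"

text \<open>
  From here on, \<open>D\<close> is the full index set and \<open>M i\<close> the \<open>i\<close>-th factor, so \<open>\<lambda>\<^sub>I\<close> is \<open>Pi\<^sub>M I M\<close>.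
\<close>

definition B2_on :: "('i \<Rightarrow> 'a measure) \<Rightarrow> 'i set \<Rightarrow> 'i set \<Rightarrow> (('i \<Rightarrow> 'a) \<Rightarrow> real) set" where
  "B2_on M D I =
     {f \<in> B2 (Pi\<^sub>M D M). \<exists>g\<in>B2 (Pi\<^sub>M I M). bayes_eq (Pi\<^sub>M D M) f (\<lambda>x. g (restrict x I))}"

text \<open>
  The margin over \<open>I\<close> is kept as a function on the full product space; \<open>merge I (D - I) (x, y)\<close>
  takes its coordinates in \<open>I\<close> from \<open>x\<close> and the remaining ones from \<open>y\<close>.
\<close>

definition geom_margin ::
    "('i \<Rightarrow> 'a measure) \<Rightarrow> 'i set \<Rightarrow> (('i \<Rightarrow> 'a) \<Rightarrow> real) \<Rightarrow> 'i set \<Rightarrow> ('i \<Rightarrow> 'a) \<Rightarrow> real" where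
  "geom_margin M D f I =
     (if I = D then f
      else (\<lambda>x. exp (1 / measure (Pi\<^sub>M (D - I) M) (space (Pi\<^sub>M (D - I) M)) *
                  (\<integral>y. ln (f (merge I (D - I) (x, y))) \<partial>(Pi\<^sub>M (D - I) M)))))"

definition interaction_part ::
    "('i \<Rightarrow> 'a measure) \<Rightarrow> 'i set \<Rightarrow> (('i \<Rightarrow> 'a) \<Rightarrow> real) \<Rightarrow> 'i set \<Rightarrow> ('i \<Rightarrow> 'a) \<Rightarrow> real" where
  "interaction_part M D f I =
     bayes_bigadd {J. J \<noteq> {} \<and> J \<subseteq> I}
       (\<lambda>J. bayes_scale ((-1) ^ card (I - J)) (geom_margin M D f J))"

lemma bayes_sum_space_cong [fundef_cong]:
  assumes "L = L'" "K = K'" "\<And>k. k \<in> K' \<Longrightarrow> W k = W' k"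
  shows "bayes_sum_space L K W = bayes_sum_space L' K' W'"
  using assms by (simp add: bayes_sum_space_def cong: conj_cong)

text \<open>
  The one-factor spaces are indexed by singletons \<open>J = {i}\<close>, so that the two families of summands
  of \<open>B2_I,\<oplus>\<close> become one family over the non-empty proper subsets of \<open>I\<close>. The value for
  \<open>card I < 2\<close> (which includes infinite \<open>I\<close>) is a dummy.
\<close>

function interaction_space ::
    "('i \<Rightarrow> 'a measure) \<Rightarrow> 'i set \<Rightarrow> 'i set \<Rightarrow> (('i \<Rightarrow> 'a) \<Rightarrow> real) set" where
  "interaction_space M D I =
     (if card I < 2 then {}
      else {f \<in> B2_on M D I.
              \<forall>g \<in> bayes_sum_space (Pi\<^sub>M D M) {J. J \<noteq> {} \<and> J \<subset> I}
                     (\<lambda>J. if card J = 1 then B2_on M D J else interaction_space M D J).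
                bayes_inner (Pi\<^sub>M D M) f g = 0})"
  by pat_completeness auto
termination
  by (relation "Wellfounded.measure (\<lambda>(M, D, I). card I)")
    (auto intro!: psubset_card_mono intro: card_ge_0_finite)

declare interaction_space.simps [simp del]

definition component_space ::
    "('i \<Rightarrow> 'a measure) \<Rightarrow> 'i set \<Rightarrow> 'i set \<Rightarrow> (('i \<Rightarrow> 'a) \<Rightarrow> real) set" where
  "component_space M D I = (if card I = 1 then B2_on M D I else interaction_space M D I)"

end

theory Submission imports Defs begin

text \<open>
  The logarithm turns the Bayes space into \<open>L\<^sup>2(\<lambda>)\<close> modulo constants, and the inner product into the
  (unnormalised) covariance of logarithms (\<open>bayes_inner_eq_covariance\<close>). In this picture the
  theorem is the functional ANOVA (Hoeffding) decomposition for a product measure.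

  The geometric margin over \<open>I\<close> averages the log-density over the coordinates outside \<open>I\<close>. By Fubini
  it is the orthogonal projection onto the densities that depend on the coordinates in \<open>I\<close> only
  (\<open>geom_margin_in_B2_on\<close>, \<open>inner_geom_margin\<close>). Averaging over further coordinates can only remove
  dependencies: the margin over \<open>I\<close> of a density of the coordinates in \<open>K\<close> is a density of those in
  \<open>I \<inter> K\<close> (\<open>geom_margin_in_B2_on_Int\<close>). Hence, tested against a density of the coordinates in \<open>K\<close>,
  the margin over \<open>J\<close> acts through \<open>J \<inter> K\<close> alone (\<open>inner_geom_margin_swap\<close>).

  Two facts about alternating sums over subsets finish the argument. If \<open>I\<close> contains an index \<open>i\<close>
  outside \<open>K\<close>, the terms \<open>J\<close> and \<open>J \<union> {i}\<close> of the sum that defines the interaction part cancel against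
  every density of the coordinates in \<open>K\<close>, so the interaction part is orthogonal to all of these
  (\<open>interaction_part_orthogonal\<close>). And by Moebius inversion a density is the \<open>\<oplus>\<close>-sum of its
  interaction parts (\<open>B2_on_eq_bigadd_interaction_parts\<close>).

  The recursively defined interaction spaces are handled through a direct description: \<open>pure_space I\<close>
  consists of the densities of the coordinates in \<open>I\<close> that are orthogonal to all densities of fewer
  of these coordinates. Moebius inversion shows that the two descriptions agree
  (\<open>component_space_eq_pure_space\<close>). Mutual orthogonality is a property of pure spaces, and in the
  expansion of a density \<open>f\<close> the \<open>I\<close>-th summand lies in \<open>pure_space I\<close> while all others are
  orthogonal to that space; this makes it the projection of \<open>f\<close>.
\<close>

section \<open>Covariance form of the Bayes inner product\<close>

lemma bayes_measurable: "f \<in> bayes L \<Longrightarrow> f \<in> borel_measurable L"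
  by (simp add: bayes_def)

locale reference_measure = finite_measure L for L :: "'w measure" +
  assumes nonzero: "emeasure L (space L) \<noteq> 0"
begin

abbreviation total_mass :: real where
  "total_mass \<equiv> measure L (space L)"

lemma total_mass_pos: "0 < total_mass"
  using nonzero by (simp add: emeasure_eq_measure zero_less_measure_iff)

text \<open>
  The Cauchy-Schwarz inequality against the constant \<open>1\<close>: it says that the variance is non-negative.
  It is what keeps averaged log-densities square integrable.
\<close>

lemma square_integral_le:
  assumes [measurable]: "h \<in> borel_measurable L" and sq: "integrable L (\<lambda>x. (h x)\<^sup>2)"
  shows "(\<integral>x. h x \<partial>L)\<^sup>2 \<le> total_mass * (\<integral>x. (h x)\<^sup>2 \<partial>L)"
proof -
  have h: "integrable L h" using square_integrable_imp_integrable[OF _ sq] by simp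
  define a where "a = (\<integral>x. h x \<partial>L) / total_mass"
  have "0 \<le> (\<integral>x. (h x - a)\<^sup>2 \<partial>L)" by simp
  also have "\<dots> = (\<integral>x. (h x)\<^sup>2 - 2 * a * h x + a\<^sup>2 \<partial>L)"
    by (simp add: power2_diff algebra_simps)
  also have "\<dots> = (\<integral>x. (h x)\<^sup>2 \<partial>L) - 2 * a * (\<integral>x. h x \<partial>L) + total_mass * a\<^sup>2"
    using h sq by simp
  also have "\<dots> = (\<integral>x. (h x)\<^sup>2 \<partial>L) - (\<integral>x. h x \<partial>L)\<^sup>2 / total_mass"
    using total_mass_pos by (simp add: a_def field_simps power2_eq_square)
  finally show ?thesis
    using total_mass_pos by (simp add: field_simps)
qed

text \<open>
  The density measure gives mass zero to the set where \<open>f\<close> is not positive, so equality of the null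
  sets forces positivity almost everywhere; \<open>\<sigma>\<close>-finiteness follows since \<open>f\<close> takes finite values.
  On the exceptional null set \<open>f\<close> may be non-positive, which is why the rules for \<open>ln\<close> are applied
  only almost everywhere below.
\<close>

lemma bayes_iff: "f \<in> bayes L \<longleftrightarrow> f \<in> borel_measurable L \<and> (AE x in L. 0 < f x)"
proof (cases "f \<in> borel_measurable L")
  case [measurable]: True
  let ?N = "density L (\<lambda>x. ennreal (f x))"
  have sf: "sigma_finite_measure ?N"
    by (subst sigma_finite_iff_density_finite) auto
  have "null_sets ?N = null_sets L \<longleftrightarrow> (AE x in L. 0 < f x)"
  proof
    assume eq: "null_sets ?N = null_sets L"
    let ?A = "{x \<in> space L. \<not> 0 < f x}"
    have "?A \<in> null_sets ?N"
      by (subst null_sets_density_iff) (auto simp: ennreal_eq_0_iff)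
    then have "?A \<in> null_sets L" using eq by simp
    then show "AE x in L. 0 < f x"
      by (rule AE_I') auto
  next
    assume pos: "AE x in L. 0 < f x"
    show "null_sets ?N = null_sets L"
    proof (intro set_eqI iffI)
      fix A assume "A \<in> null_sets ?N"
      then have A: "A \<in> sets L" "AE x in L. x \<in> A \<longrightarrow> ennreal (f x) = 0"
        by (auto simp: null_sets_density_iff)
      have "AE x in L. x \<notin> A"
        using A(2) pos by eventually_elim (auto simp: ennreal_eq_0_iff)
      then show "A \<in> null_sets L"
        using A(1) by (simp add: AE_iff_null_sets)
    next
      fix A assume "A \<in> null_sets L"
      then show "A \<in> null_sets ?N"
        by (auto simp: null_sets_density_iff intro: AE_not_in[THEN eventually_mono])
    qed
  qed
  then show ?thesis
    using sf by (simp add: bayes_def bayes_measures_def)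
qed (simp add: bayes_def)

lemma B2_iff:
  "f \<in> B2 L \<longleftrightarrow>
     f \<in> borel_measurable L \<and> (AE x in L. 0 < f x) \<and> integrable L (\<lambda>x. (ln (f x))\<^sup>2)"
  by (auto simp: B2_def bayes_iff)

lemma B2_measurable [measurable_dest]: "f \<in> B2 L \<Longrightarrow> f \<in> borel_measurable L"
  and B2_pos: "f \<in> B2 L \<Longrightarrow> AE x in L. 0 < f x"
  and B2_square_integrable: "f \<in> B2 L \<Longrightarrow> integrable L (\<lambda>x. (ln (f x))\<^sup>2)"
  by (auto simp: B2_iff)

lemma B2_bayes: "f \<in> B2 L \<Longrightarrow> f \<in> bayes L"
  by (simp add: B2_def)

lemma B2_integrable_mult:
  assumes f [measurable]: "f \<in> B2 L" and g [measurable]: "g \<in> B2 L"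
  shows "integrable L (\<lambda>x. ln (f x) * ln (g x))"
proof (rule Bochner_Integration.integrable_bound)
  show "integrable L (\<lambda>x. (ln (f x))\<^sup>2 + (ln (g x))\<^sup>2)"
    using B2_square_integrable[OF f] B2_square_integrable[OF g] by simp
  show "AE x in L. norm (ln (f x) * ln (g x)) \<le> norm ((ln (f x))\<^sup>2 + (ln (g x))\<^sup>2)"
  proof (rule AE_I2)
    fix x
    have "2 * \<bar>ln (f x)\<bar> * \<bar>ln (g x)\<bar> \<le> \<bar>ln (f x)\<bar>\<^sup>2 + \<bar>ln (g x)\<bar>\<^sup>2"
      by (rule sum_squares_bound)
    moreover have "0 \<le> \<bar>ln (f x)\<bar> * \<bar>ln (g x)\<bar>" by simp
    ultimately show "norm (ln (f x) * ln (g x)) \<le> norm ((ln (f x))\<^sup>2 + (ln (g x))\<^sup>2)"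
      unfolding real_norm_def abs_mult power2_abs by linarith
  qed
qed measurable

lemma B2_const: "0 < c \<Longrightarrow> (\<lambda>x. c) \<in> B2 L"
  by (simp add: B2_iff)

lemma B2_integrable: "f \<in> B2 L \<Longrightarrow> integrable L (\<lambda>x. ln (f x))"
  using B2_integrable_mult[of f "\<lambda>x. exp 1"] by (simp add: B2_const)

lemma bayes_eq_B2:
  assumes f: "f \<in> B2 L" and g [measurable]: "g \<in> borel_measurable L" and eq: "bayes_eq L g f"
  shows "g \<in> B2 L"
proof -
  obtain c where c: "0 < c" "AE x in L. g x = c * f x"
    using eq by (auto simp: bayes_eq_def)
  have [measurable]: "f \<in> borel_measurable L" using f by (simp add: B2_iff)
  have pos: "AE x in L. 0 < g x"
    using c(2) B2_pos[OF f] by eventually_elim (simp add: c(1))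
  have ln: "AE x in L. (ln c)\<^sup>2 + (ln (f x))\<^sup>2 + 2 * ln c * ln (f x) = (ln (g x))\<^sup>2"
    using c(2) B2_pos[OF f]
    by eventually_elim (use c(1) in \<open>simp add: ln_mult_pos power2_sum\<close>)
  have "integrable L (\<lambda>x. (ln c)\<^sup>2 + (ln (f x))\<^sup>2 + 2 * ln c * ln (f x))"
    using B2_integrable[OF f] B2_square_integrable[OF f] by simp
  then have "integrable L (\<lambda>x. (ln (g x))\<^sup>2)"
    by (rule integrable_cong_AE_imp) (use ln in \<open>auto elim: eventually_mono\<close>)
  with pos show ?thesis by (simp add: B2_iff)
qed

lemma bayes_add_B2:
  assumes f: "f \<in> B2 L" and g: "g \<in> B2 L"
  shows "bayes_add f g \<in> B2 L"
proof -
  have [measurable]: "f \<in> borel_measurable L" "g \<in> borel_measurable L"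
    using f g by (simp_all add: B2_iff)
  have pos: "AE x in L. 0 < f x * g x"
    using B2_pos[OF f] B2_pos[OF g] by eventually_elim simp
  have ln: "AE x in L. (ln (f x))\<^sup>2 + (ln (g x))\<^sup>2 + 2 * (ln (f x) * ln (g x)) = (ln (f x * g x))\<^sup>2"
    using B2_pos[OF f] B2_pos[OF g] by eventually_elim (simp add: ln_mult power2_sum)
  have "integrable L (\<lambda>x. (ln (f x))\<^sup>2 + (ln (g x))\<^sup>2 + 2 * (ln (f x) * ln (g x)))"
    using B2_square_integrable[OF f] B2_square_integrable[OF g] B2_integrable_mult[OF f g] by simp
  then have "integrable L (\<lambda>x. (ln (f x * g x))\<^sup>2)"
    by (rule integrable_cong_AE_imp) (use ln in \<open>auto elim: eventually_mono\<close>)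
  with pos show ?thesis by (simp add: B2_iff bayes_add_def)
qed

lemma bayes_scale_B2:
  assumes f: "f \<in> B2 L"
  shows "bayes_scale a f \<in> B2 L"
proof -
  have [measurable]: "f \<in> borel_measurable L" using f by (simp add: B2_iff)
  have pos: "AE x in L. 0 < f x powr a"
    using B2_pos[OF f] by eventually_elim simp
  have ln: "AE x in L. a\<^sup>2 * (ln (f x))\<^sup>2 = (ln (f x powr a))\<^sup>2"
    using B2_pos[OF f] by eventually_elim (simp add: ln_powr power_mult_distrib)
  have "integrable L (\<lambda>x. a\<^sup>2 * (ln (f x))\<^sup>2)"
    using B2_square_integrable[OF f] by simp
  then have "integrable L (\<lambda>x. (ln (f x powr a))\<^sup>2)"
    by (rule integrable_cong_AE_imp) (use ln in \<open>auto elim: eventually_mono\<close>)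
  with pos show ?thesis by (simp add: B2_iff bayes_scale_def)
qed

lemma bayes_diff_B2: "f \<in> B2 L \<Longrightarrow> g \<in> B2 L \<Longrightarrow> bayes_diff f g \<in> B2 L"
  by (simp add: bayes_diff_def bayes_add_B2 bayes_scale_B2)

text \<open>
  Expanding \<open>(u x - u y) * (v x - v y)\<close> for the logarithms \<open>u\<close>, \<open>v\<close> and integrating twice counts
  every term two times, which the factor \<open>1 / 2\<close> compensates. The bilinearity of the inner product and
  its invariance under \<open>\<propto>\<close> become immediate in this form.
\<close>

lemma bayes_inner_eq_covariance:
  assumes f: "f \<in> B2 L" and g: "g \<in> B2 L"
  shows "bayes_inner L f g =
    (\<integral>x. ln (f x) * ln (g x) \<partial>L) - (\<integral>x. ln (f x) \<partial>L) * (\<integral>x. ln (g x) \<partial>L) / total_mass"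
proof -
  have [measurable]: "f \<in> borel_measurable L" "g \<in> borel_measurable L"
    using f g by (simp_all add: B2_iff)
  note int = B2_integrable[OF f] B2_integrable[OF g] B2_integrable_mult[OF f g]
  define u v where "u = (\<lambda>x. ln (f x))" and "v = (\<lambda>x. ln (g x))"
  have [measurable]: "u \<in> borel_measurable L" "v \<in> borel_measurable L"
    by (simp_all add: u_def v_def)
  have [simp]: "integrable L u" "integrable L v" "integrable L (\<lambda>x. u x * v x)"
    using int by (simp_all add: u_def v_def)
  have inner: "(\<integral>x. ln (f x / f y) * ln (g x / g y) \<partial>L) =
      (\<integral>x. u x * v x \<partial>L) - v y * (\<integral>x. u x \<partial>L) - u y * (\<integral>x. v x \<partial>L) + total_mass * (u y * v y)"
    if y: "0 < f y" "0 < g y" for y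
  proof -
    have "(\<integral>x. ln (f x / f y) * ln (g x / g y) \<partial>L) =
        (\<integral>x. u x * v x - v y * u x - u y * v x + u y * v y \<partial>L)"
    proof (rule integral_cong_AE)
      show "AE x in L. ln (f x / f y) * ln (g x / g y) = u x * v x - v y * u x - u y * v x + u y * v y"
        using B2_pos[OF f] B2_pos[OF g]
        by eventually_elim (use y in \<open>simp add: u_def v_def ln_divide_pos algebra_simps\<close>)
    qed measurable
    also have "\<dots> = (\<integral>x. u x * v x \<partial>L) - v y * (\<integral>x. u x \<partial>L) - u y * (\<integral>x. v x \<partial>L)
        + total_mass * (u y * v y)"
      by simp
    finally show ?thesis .
  qed
  have "(\<integral>y. (\<integral>x. ln (f x / f y) * ln (g x / g y) \<partial>L) \<partial>L) =
     (\<integral>y. (\<integral>x. u x * v x \<partial>L) - v y * (\<integral>x. u x \<partial>L) - u y * (\<integral>x. v x \<partial>L) + total_mass * (u y * v y) \<partial>L)"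
  proof (rule integral_cong_AE)
    show "AE y in L. (\<integral>x. ln (f x / f y) * ln (g x / g y) \<partial>L) =
       (\<integral>x. u x * v x \<partial>L) - v y * (\<integral>x. u x \<partial>L) - u y * (\<integral>x. v x \<partial>L) + total_mass * (u y * v y)"
      using B2_pos[OF f] B2_pos[OF g] by eventually_elim (rule inner)
  qed measurable
  also have "\<dots> = 2 * total_mass * (\<integral>x. u x * v x \<partial>L) - 2 * (\<integral>x. u x \<partial>L) * (\<integral>x. v x \<partial>L)"
    by simp
  finally show ?thesis
    using total_mass_pos unfolding bayes_inner_def u_def v_def
    by (simp add: field_simps)
qed

lemma bayes_inner_commute:
  "f \<in> B2 L \<Longrightarrow> g \<in> B2 L \<Longrightarrow> bayes_inner L f g = bayes_inner L g f"
  by (simp add: bayes_inner_eq_covariance mult.commute)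

lemma integral_ln_add:
  assumes f: "f \<in> B2 L" and g: "g \<in> B2 L" and h: "h \<in> B2 L"
  shows "(\<integral>x. ln (bayes_add f g x) * ln (h x) \<partial>L) =
    (\<integral>x. ln (f x) * ln (h x) \<partial>L) + (\<integral>x. ln (g x) * ln (h x) \<partial>L)"
proof -
  have [measurable]: "f \<in> borel_measurable L" "g \<in> borel_measurable L" "h \<in> borel_measurable L"
    using f g h by (simp_all add: B2_iff)
  have "(\<integral>x. ln (bayes_add f g x) * ln (h x) \<partial>L) =
      (\<integral>x. ln (f x) * ln (h x) + ln (g x) * ln (h x) \<partial>L)"
    unfolding bayes_add_def
  proof (rule integral_cong_AE)
    show "AE x in L. ln (f x * g x) * ln (h x) = ln (f x) * ln (h x) + ln (g x) * ln (h x)"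
      using B2_pos[OF f] B2_pos[OF g] by eventually_elim (simp add: ln_mult algebra_simps)
  qed measurable
  then show ?thesis
    using B2_integrable_mult[OF f h] B2_integrable_mult[OF g h] by simp
qed

lemma bayes_inner_add_left:
  assumes f: "f \<in> B2 L" and g: "g \<in> B2 L" and h: "h \<in> B2 L"
  shows "bayes_inner L (bayes_add f g) h = bayes_inner L f h + bayes_inner L g h"
  using integral_ln_add[OF f g h] integral_ln_add[OF f g B2_const[of "exp 1"]]
  by (simp add: bayes_inner_eq_covariance f g h bayes_add_B2 add_divide_distrib distrib_right)

lemma bayes_inner_scale_left:
  assumes f: "f \<in> B2 L" and h: "h \<in> B2 L"
  shows "bayes_inner L (bayes_scale a f) h = a * bayes_inner L f h"
proof -
  have ln: "ln (bayes_scale a f x) = a * ln (f x)" for x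
    by (simp add: bayes_scale_def powr_def)
  show ?thesis
    by (simp add: bayes_inner_eq_covariance f h bayes_scale_B2 ln algebra_simps)
qed

lemma bayes_inner_const_left:
  "(\<lambda>x. c) \<in> B2 L \<Longrightarrow> h \<in> B2 L \<Longrightarrow> bayes_inner L (\<lambda>x. c) h = 0"
  using total_mass_pos by (simp add: bayes_inner_eq_covariance)

lemma bayes_inner_cong_left:
  assumes f: "f \<in> B2 L" and h: "h \<in> B2 L" and g: "g \<in> B2 L" and eq: "bayes_eq L f g"
  shows "bayes_inner L f h = bayes_inner L g h"
proof -
  obtain c where c: "0 < c" "AE x in L. f x = c * g x"
    using eq by (auto simp: bayes_eq_def)
  let ?cg = "bayes_add (\<lambda>x. c) g"
  have cg: "?cg \<in> B2 L" by (intro bayes_add_B2 B2_const c g)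
  have [measurable]: "f \<in> borel_measurable L" "g \<in> borel_measurable L" "h \<in> borel_measurable L"
    using f g h by (simp_all add: B2_iff)
  have "(\<integral>x. ln (f x) * ln (h x) \<partial>L) = (\<integral>x. ln (?cg x) * ln (h x) \<partial>L)"
       "(\<integral>x. ln (f x) \<partial>L) = (\<integral>x. ln (?cg x) \<partial>L)"
    using c(2) by (auto intro!: integral_cong_AE elim: eventually_mono simp: bayes_add_def)
  then have "bayes_inner L f h = bayes_inner L ?cg h"
    by (simp add: bayes_inner_eq_covariance f h cg)
  also have "\<dots> = bayes_inner L g h"
    by (simp add: bayes_inner_add_left bayes_inner_const_left B2_const c(1) g h)
  finally show ?thesis .
qed

lemma bayes_inner_diff_left:
  "f \<in> B2 L \<Longrightarrow> g \<in> B2 L \<Longrightarrow> h \<in> B2 L \<Longrightarrow>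
    bayes_inner L (bayes_diff f g) h = bayes_inner L f h - bayes_inner L g h"
  by (simp add: bayes_diff_def bayes_inner_add_left bayes_inner_scale_left bayes_scale_B2)

lemma bigadd_empty: "bayes_bigadd {} w = (\<lambda>x. 1)"
  by (simp add: bayes_bigadd_def)

lemma bigadd_insert:
  "finite K \<Longrightarrow> k \<notin> K \<Longrightarrow> bayes_bigadd (insert k K) w = bayes_add (w k) (bayes_bigadd K w)"
  by (simp add: bayes_bigadd_def bayes_add_def)

lemma bayes_bigadd_B2:
  "finite K \<Longrightarrow> (\<And>k. k \<in> K \<Longrightarrow> w k \<in> B2 L) \<Longrightarrow> bayes_bigadd K w \<in> B2 L"
  by (induction K rule: finite_induct)
    (auto simp: bigadd_empty bigadd_insert B2_const intro!: bayes_add_B2)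

lemma bayes_inner_bigadd_left:
  "finite K \<Longrightarrow> (\<And>k. k \<in> K \<Longrightarrow> w k \<in> B2 L) \<Longrightarrow> h \<in> B2 L \<Longrightarrow>
    bayes_inner L (bayes_bigadd K w) h = (\<Sum>k\<in>K. bayes_inner L (w k) h)"
proof (induction K rule: finite_induct)
  case empty
  then show ?case by (simp add: bigadd_empty bayes_inner_const_left B2_const)
next
  case (insert k K)
  then show ?case
    by (simp add: bigadd_insert bayes_inner_add_left bayes_bigadd_B2)
qed

lemma bayes_inner_self_zero:
  assumes f: "f \<in> B2 L" and z: "bayes_inner L f f = 0"
  shows "bayes_eq L f (\<lambda>x. 1)"
proof -
  \<comment> \<open>The inner product of \<open>f\<close> with itself is the integral of \<open>(ln f - a)\<^sup>2\<close> for the mean \<open>a\<close>,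
    so \<open>ln f\<close> is almost everywhere equal to its mean.\<close>
  define a where "a = (\<integral>x. ln (f x) \<partial>L) / total_mass"
  have [measurable]: "f \<in> borel_measurable L" using f by (simp add: B2_iff)
  have eq: "(ln (f x) - a)\<^sup>2 = (ln (f x))\<^sup>2 - 2 * a * ln (f x) + a\<^sup>2" for x
    by (simp add: power2_diff algebra_simps)
  have int: "integrable L (\<lambda>x. (ln (f x) - a)\<^sup>2)"
    unfolding eq using B2_integrable[OF f] B2_square_integrable[OF f] by simp
  have "(\<integral>x. (ln (f x) - a)\<^sup>2 \<partial>L) = (\<integral>x. (ln (f x))\<^sup>2 \<partial>L) - 2 * a * (\<integral>x. ln (f x) \<partial>L) + total_mass * a\<^sup>2"
    unfolding eq using B2_integrable[OF f] B2_square_integrable[OF f] by simp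
  also have "\<dots> = bayes_inner L f f"
    using total_mass_pos
    by (simp add: bayes_inner_eq_covariance f a_def field_simps power2_eq_square)
  finally have "AE x in L. (ln (f x) - a)\<^sup>2 = 0"
    using integral_nonneg_eq_0_iff_AE[OF int] z by simp
  then have "AE x in L. f x = exp a * 1"
    using B2_pos[OF f] by eventually_elim (simp, metis exp_ln)
  then show ?thesis by (auto simp: bayes_eq_def intro!: exI[of _ "exp a"])
qed

lemma bayes_eq_refl: "bayes_eq L f f"
  by (auto simp: bayes_eq_def intro!: exI[of _ 1])

lemma bayes_eq_sym: "bayes_eq L f g \<Longrightarrow> bayes_eq L g f"
  unfolding bayes_eq_def
proof (elim exE conjE)
  fix c :: real assume c: "0 < c" "AE x in L. f x = c * g x"
  have "AE x in L. g x = inverse c * f x"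
    using c(2) by eventually_elim (use c(1) in simp)
  with c(1) show "\<exists>c>0. AE x in L. g x = c * f x"
    by (intro exI[of _ "inverse c"]) simp
qed

lemma bayes_eq_trans: "bayes_eq L f g \<Longrightarrow> bayes_eq L g h \<Longrightarrow> bayes_eq L f h"
  unfolding bayes_eq_def
proof (elim exE conjE)
  fix c c' :: real
  assume c: "0 < c" "AE x in L. f x = c * g x" and c': "0 < c'" "AE x in L. g x = c' * h x"
  have "AE x in L. f x = (c * c') * h x"
    using c(2) c'(2) by eventually_elim simp
  with c(1) c'(1) show "\<exists>c>0. AE x in L. f x = c * h x"
    by (intro exI[of _ "c * c'"]) simp
qed

lemma AE_bayes_eq: "AE x in L. f x = g x \<Longrightarrow> bayes_eq L f g"
  by (auto simp: bayes_eq_def intro!: exI[of _ 1])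

lemma bayes_eq_add:
  "bayes_eq L f f' \<Longrightarrow> bayes_eq L g g' \<Longrightarrow> bayes_eq L (bayes_add f g) (bayes_add f' g')"
  unfolding bayes_eq_def bayes_add_def
proof (elim exE conjE)
  fix c c' :: real
  assume c: "0 < c" "AE x in L. f x = c * f' x" and c': "0 < c'" "AE x in L. g x = c' * g' x"
  have "AE x in L. f x * g x = (c * c') * (f' x * g' x)"
    using c(2) c'(2) by eventually_elim simp
  with c(1) c'(1) show "\<exists>c>0. AE x in L. f x * g x = c * (f' x * g' x)"
    by (intro exI[of _ "c * c'"]) simp
qed

lemma bayes_eq_scale:
  assumes f': "f' \<in> B2 L" and eq: "bayes_eq L f f'"
  shows "bayes_eq L (bayes_scale a f) (bayes_scale a f')"
proof -
  obtain c where c: "0 < c" "AE x in L. f x = c * f' x"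
    using eq by (auto simp: bayes_eq_def)
  have "AE x in L. f x powr a = c powr a * f' x powr a"
    using c(2) B2_pos[OF f'] by eventually_elim (use c(1) in \<open>simp add: powr_mult\<close>)
  with c(1) show ?thesis
    unfolding bayes_eq_def bayes_scale_def by (intro exI[of _ "c powr a"]) simp
qed

lemma bayes_eq_iff_diff:
  assumes f: "f \<in> B2 L" and g: "g \<in> B2 L"
  shows "bayes_eq L f g \<longleftrightarrow> bayes_inner L (bayes_diff f g) (bayes_diff f g) = 0"
proof
  assume "bayes_eq L f g"
  then have "bayes_inner L f h = bayes_inner L g h" if "h \<in> B2 L" for h
    using bayes_inner_cong_left f g that by blast
  then show "bayes_inner L (bayes_diff f g) (bayes_diff f g) = 0"
    by (simp add: bayes_inner_diff_left f g bayes_diff_B2)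
next
  assume "bayes_inner L (bayes_diff f g) (bayes_diff f g) = 0"
  then have "bayes_eq L (bayes_diff f g) (\<lambda>x. 1)"
    by (intro bayes_inner_self_zero bayes_diff_B2 f g)
  then have "bayes_eq L (bayes_add (bayes_diff f g) g) (bayes_add (\<lambda>x. 1) g)"
    by (intro bayes_eq_add bayes_eq_refl)
  moreover have "AE x in L. f x = bayes_add (bayes_diff f g) g x"
    using B2_pos[OF g]
    by eventually_elim (simp add: bayes_add_def bayes_diff_def bayes_scale_def powr_minus)
  moreover have "bayes_add (\<lambda>x. 1) g = g" by (simp add: bayes_add_def)
  ultimately show "bayes_eq L f g"
    using bayes_eq_trans AE_bayes_eq by metis
qed

section \<open>Subspaces of the Bayes space\<close>

lemma subspace_B2: "bayes_subspace L V \<Longrightarrow> f \<in> V \<Longrightarrow> f \<in> B2 L"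
  and subspace_one: "bayes_subspace L V \<Longrightarrow> (\<lambda>x. 1) \<in> V"
  and subspace_add: "bayes_subspace L V \<Longrightarrow> f \<in> V \<Longrightarrow> g \<in> V \<Longrightarrow> bayes_add f g \<in> V"
  and subspace_scale: "bayes_subspace L V \<Longrightarrow> f \<in> V \<Longrightarrow> bayes_scale a f \<in> V"
  by (auto simp: bayes_subspace_def)

lemma subspace_cong:
  "bayes_subspace L V \<Longrightarrow> f \<in> V \<Longrightarrow> g \<in> bayes L \<Longrightarrow> bayes_eq L g f \<Longrightarrow> g \<in> V"
  by (auto simp: bayes_subspace_def)

lemma subspace_diff: "bayes_subspace L V \<Longrightarrow> f \<in> V \<Longrightarrow> g \<in> V \<Longrightarrow> bayes_diff f g \<in> V"
  by (simp add: bayes_diff_def subspace_add subspace_scale)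

lemma subspace_bigadd:
  "bayes_subspace L V \<Longrightarrow> finite K \<Longrightarrow> (\<And>k. k \<in> K \<Longrightarrow> w k \<in> V) \<Longrightarrow> bayes_bigadd K w \<in> V"
  by (rotate_tac 1, induction K rule: finite_induct)
    (auto simp: bigadd_empty bigadd_insert subspace_one intro!: subspace_add)

lemma bayes_subspace_orthogonal_complement:
  assumes V: "bayes_subspace L V" and S: "S \<subseteq> B2 L"
  shows "bayes_subspace L {f \<in> V. \<forall>g\<in>S. bayes_inner L f g = 0}"
  unfolding bayes_subspace_def
proof (intro conjI ballI allI impI)
  fix f g assume f: "f \<in> {f \<in> V. \<forall>g\<in>S. bayes_inner L f g = 0}" and g: "g \<in> bayes L" "bayes_eq L g f"
  then have "g \<in> V" using subspace_cong[OF V] by blast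
  with f g S show "g \<in> {f \<in> V. \<forall>g\<in>S. bayes_inner L f g = 0}"
    by (auto simp: subset_eq subspace_B2[OF V] bayes_inner_cong_left[of g _ f])
next
  show "{f \<in> V. \<forall>g\<in>S. bayes_inner L f g = 0} \<subseteq> B2 L"
    using subspace_B2[OF V] by blast
  show "(\<lambda>x. 1) \<in> {f \<in> V. \<forall>g\<in>S. bayes_inner L f g = 0}"
    using S by (simp add: subset_iff subspace_one[OF V] bayes_inner_const_left B2_const)
next
  fix f g assume "f \<in> {f \<in> V. \<forall>g\<in>S. bayes_inner L f g = 0}" "g \<in> {f \<in> V. \<forall>g\<in>S. bayes_inner L f g = 0}"
  then show "bayes_add f g \<in> {f \<in> V. \<forall>g\<in>S. bayes_inner L f g = 0}"
    using S by (simp add: subset_iff subspace_B2[OF V] subspace_add[OF V] bayes_inner_add_left)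
next
  fix f a assume "f \<in> {f \<in> V. \<forall>g\<in>S. bayes_inner L f g = 0}"
  then show "bayes_scale a f \<in> {f \<in> V. \<forall>g\<in>S. bayes_inner L f g = 0}"
    using S by (simp add: subset_iff subspace_B2[OF V] subspace_scale[OF V] bayes_inner_scale_left)
qed

text \<open>
  Margins and projections are compared through this principle, which avoids arguing about null sets of
  product spaces.
\<close>

lemma eq_if_inner_eq:
  assumes V: "bayes_subspace L V" and f: "f \<in> V" and g: "g \<in> V"
    and eq: "\<And>h. h \<in> V \<Longrightarrow> bayes_inner L f h = bayes_inner L g h"
  shows "bayes_eq L f g"
  using eq[OF subspace_diff[OF V f g]]
  by (simp add: bayes_eq_iff_diff subspace_B2[OF V] f g bayes_inner_diff_left bayes_diff_B2)

lemma bayes_projection_unique: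
  assumes V: "bayes_subspace L V" and f: "f \<in> B2 L"
    and p: "is_bayes_projection L V f p" and q: "is_bayes_projection L V f q"
  shows "bayes_eq L p q"
proof (rule eq_if_inner_eq[OF V])
  show pV: "p \<in> V" and qV: "q \<in> V" using p q by (auto simp: is_bayes_projection_def)
  fix h assume "h \<in> V"
  then have "bayes_inner L (bayes_diff f p) h = 0" "bayes_inner L (bayes_diff f q) h = 0"
    using p q by (auto simp: is_bayes_projection_def)
  then show "bayes_inner L p h = bayes_inner L q h"
    using pV qV \<open>h \<in> V\<close> by (simp add: bayes_inner_diff_left f subspace_B2[OF V])
qed

text \<open>
  Testing a sum against an element of one summand of an orthogonal family isolates that summand.
\<close>

lemma orthogonal_bigadd_unique:
  assumes K: "finite K" and W: "\<And>k. k \<in> K \<Longrightarrow> bayes_subspace L (W k)"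
    and orth: "\<And>k j. k \<in> K \<Longrightarrow> j \<in> K \<Longrightarrow> k \<noteq> j \<Longrightarrow> bayes_orthogonal L (W k) (W j)"
    and w: "\<And>k. k \<in> K \<Longrightarrow> w k \<in> W k" and w': "\<And>k. k \<in> K \<Longrightarrow> w' k \<in> W k"
    and eq: "bayes_eq L (bayes_bigadd K w) (bayes_bigadd K w')" and j: "j \<in> K"
  shows "bayes_eq L (w j) (w' j)"
proof (rule eq_if_inner_eq[OF W[OF j] w[OF j] w'[OF j]])
  fix h assume h: "h \<in> W j"
  have hB: "h \<in> B2 L" by (rule subspace_B2[OF W[OF j] h])
  have B: "w k \<in> B2 L" "w' k \<in> B2 L" if "k \<in> K" for k
    using subspace_B2[OF W[OF that]] w w' that by auto
  have pick: "bayes_inner L (bayes_bigadd K v) h = bayes_inner L (v j) h"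
    if v: "\<And>k. k \<in> K \<Longrightarrow> v k \<in> W k" for v
  proof -
    have vB: "v k \<in> B2 L" if "k \<in> K" for k
      using subspace_B2[OF W[OF that] v[OF that]] .
    have "bayes_inner L (bayes_bigadd K v) h = (\<Sum>k\<in>K. bayes_inner L (v k) h)"
      by (rule bayes_inner_bigadd_left[OF K vB hB])
    also have "\<dots> = (\<Sum>k\<in>K. if k = j then bayes_inner L (v j) h else 0)"
      using orth[OF _ j] v h by (intro sum.cong) (auto simp: bayes_orthogonal_def)
    also have "\<dots> = bayes_inner L (v j) h" using K j by simp
    finally show ?thesis .
  qed
  have "bayes_inner L (bayes_bigadd K w) h = bayes_inner L (bayes_bigadd K w') h"
    by (intro bayes_inner_cong_left bayes_bigadd_B2 K B hB eq)
  then show "bayes_inner L (w j) h = bayes_inner L (w' j) h"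
    using pick[of w] pick[of w'] w w' by simp
qed

end

section \<open>Alternating sums over subsets\<close>

text \<open>
  Adding or removing \<open>i\<close> pairs up the subsets of \<open>I\<close>; the two members of a pair have opposite signs
  and the same value of \<open>b\<close>.
\<close>

lemma alternating_sum_toggle:
  fixes b :: "'i set \<Rightarrow> real"
  assumes I: "finite I" and i: "i \<in> I"
    and b: "\<And>J. J \<subseteq> I \<Longrightarrow> i \<notin> J \<Longrightarrow> b (insert i J) = b J"
  shows "(\<Sum>J\<in>Pow I. (-1) ^ card (I - J) * b J) = 0"
proof -
  define I' where "I' = I - {i}"
  have I': "I = insert i I'" "i \<notin> I'" "finite I'" using I i by (auto simp: I'_def)
  have inj: "inj_on (insert i) (Pow I')"
    using I'(2) by (auto intro!: inj_onI dest: insert_ident[THEN iffD1, rotated 2])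
  have "(\<Sum>J\<in>Pow I. (-1) ^ card (I - J) * b J) =
      (\<Sum>J\<in>Pow I'. (-1) ^ card (I - J) * b J) + (\<Sum>J\<in>insert i ` Pow I'. (-1) ^ card (I - J) * b J)"
    unfolding I'(1) Pow_insert using I' by (intro sum.union_disjoint) auto
  also have "(\<Sum>J\<in>insert i ` Pow I'. (-1) ^ card (I - J) * b J) =
      (\<Sum>J\<in>Pow I'. (-1) ^ card (I - insert i J) * b (insert i J))"
    by (simp add: sum.reindex[OF inj])
  also have "(\<Sum>J\<in>Pow I'. (-1) ^ card (I - J) * b J) + \<dots> = (\<Sum>J\<in>Pow I'. 0)"
    unfolding sum.distrib[symmetric]
  proof (rule sum.cong[OF refl])
    fix J assume J: "J \<in> Pow I'"
    have "I - J = insert i (I - insert i J)" "i \<notin> I - insert i J" "finite (I - insert i J)"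
      using J I' by auto
    then have "card (I - J) = Suc (card (I - insert i J))" by (metis card_insert_disjoint)
    moreover have "b (insert i J) = b J" using J I' by (intro b) auto
    ultimately show "(-1) ^ card (I - J) * b J + (-1) ^ card (I - insert i J) * b (insert i J) = 0"
      by simp
  qed
  finally show ?thesis by simp
qed

text \<open>
  After exchanging the sums, the coefficient of \<open>a K\<close> is the alternating sum over the sets between
  \<open>K\<close> and \<open>I\<close>. It cancels by toggling an index in \<open>I - K\<close>, unless \<open>K = I\<close>.
\<close>

lemma Moebius_inversion_subsets:
  fixes a :: "'i set \<Rightarrow> real"
  assumes I: "finite I" "I \<noteq> {}"
  shows "(\<Sum>J\<in>{J. J \<noteq> {} \<and> J \<subseteq> I}. \<Sum>K\<in>{K. K \<noteq> {} \<and> K \<subseteq> J}. (-1) ^ card (J - K) * a K) = a I"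
proof -
  let ?N = "{J. J \<noteq> {} \<and> J \<subseteq> I}"
  have fin: "finite ?N" using I(1) by (intro finite_subset[of ?N "Pow I"]) auto
  have coef: "(\<Sum>J\<in>Pow I. (-1) ^ card (I - J) * of_bool (K \<subseteq> J)) = (if K = I then 1 else 0 :: real)"
    if K: "K \<subseteq> I" for K
  proof (cases "K = I")
    case True
    have "(\<Sum>J\<in>Pow I. (-1) ^ card (I - J) * of_bool (K \<subseteq> J)) = (\<Sum>J\<in>Pow I. if J = I then 1 else 0 :: real)"
      using True by (intro sum.cong) auto
    then show ?thesis using I(1) True by simp
  next
    case False
    then obtain i where "i \<in> I" "i \<notin> K" using K by blast
    then show ?thesis
      using alternating_sum_toggle[OF I(1), of i "\<lambda>J. of_bool (K \<subseteq> J)"] False by (auto simp: subset_insert)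
  qed
  \<comment> \<open>Moves the dependence on \<open>K\<close> out of the exponent, so that the inner sum over \<open>J\<close> has the
    form treated by \<open>coef\<close>.\<close>
  have sign: "(-1) ^ card (J - K) = (-1) ^ card (I - K) * ((-1) ^ card (I - J) :: real)"
    if "K \<subseteq> J" "J \<subseteq> I" for J K
  proof -
    have "I - K = (I - J) \<union> (J - K)" "(I - J) \<inter> (J - K) = {}" using that by auto
    moreover have "finite (I - J)" "finite (J - K)" using I(1) finite_subset[OF that(2) I(1)] by simp_all
    ultimately have "card (I - K) = card (I - J) + card (J - K)" by (simp add: card_Un_disjoint)
    moreover have "(-1) ^ card (I - J) * (-1) ^ card (I - J) = (1 :: real)"
      by (simp flip: power_mult_distrib)
    ultimately show ?thesis by (simp add: power_add mult.left_commute[of _ "(-1) ^ card (J - K)"])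
  qed
  have "(\<Sum>J\<in>?N. \<Sum>K\<in>{K. K \<noteq> {} \<and> K \<subseteq> J}. (-1) ^ card (J - K) * a K) =
      (\<Sum>J\<in>?N. \<Sum>K\<in>?N. (-1) ^ card (I - K) * a K * ((-1) ^ card (I - J) * of_bool (K \<subseteq> J)))"
  proof (rule sum.cong[OF refl])
    fix J assume J: "J \<in> ?N"
    have "(\<Sum>K\<in>{K. K \<noteq> {} \<and> K \<subseteq> J}. (-1) ^ card (J - K) * a K) =
        (\<Sum>K\<in>{K. K \<noteq> {} \<and> K \<subseteq> J}. (-1) ^ card (I - K) * a K * ((-1) ^ card (I - J) * of_bool (K \<subseteq> J)))"
      using J by (intro sum.cong refl) (simp add: sign[where J = J])
    also have "\<dots> = (\<Sum>K\<in>?N. (-1) ^ card (I - K) * a K * ((-1) ^ card (I - J) * of_bool (K \<subseteq> J)))"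
      using J fin by (intro sum.mono_neutral_left) auto
    finally show "(\<Sum>K\<in>{K. K \<noteq> {} \<and> K \<subseteq> J}. (-1) ^ card (J - K) * a K) = \<dots>" .
  qed
  also have "\<dots> = (\<Sum>K\<in>?N. (-1) ^ card (I - K) * a K * (\<Sum>J\<in>?N. (-1) ^ card (I - J) * of_bool (K \<subseteq> J)))"
    by (subst sum.swap) (simp add: sum_distrib_left)
  also have "\<dots> = (\<Sum>K\<in>?N. (-1) ^ card (I - K) * a K * (\<Sum>J\<in>Pow I. (-1) ^ card (I - J) * of_bool (K \<subseteq> J)))"
    using I(1) by (intro sum.cong refl arg_cong2[where f = "(*)"] sum.mono_neutral_left) auto
  also have "\<dots> = (\<Sum>K\<in>?N. if K = I then a I else 0)"
    by (intro sum.cong refl) (auto simp: coef)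
  also have "\<dots> = a I" using I fin by simp
  finally show ?thesis .
qed

section \<open>Splitting a finite product measure\<close>

locale reference_product =
  fixes M :: "'i \<Rightarrow> 'a measure" and D :: "'i set"
  assumes finite_D: "finite D"
    and finite_factor: "\<And>i. i \<in> D \<Longrightarrow> finite_measure (M i)"
    and nonzero_factor: "\<And>i. i \<in> D \<Longrightarrow> emeasure (M i) (space (M i)) \<noteq> 0"
begin

text \<open>
  The locale \<open>product_sigma_finite\<close> is about families that are \<open>\<sigma>\<close>-finite at every index, whereas
  nothing is known about \<open>M\<close> outside \<open>D\<close>. Putting the measure on the empty space there leaves all
  products over subsets of \<open>D\<close> unchanged.
\<close>

definition factor :: "'i \<Rightarrow> 'a measure" where
  "factor i = (if i \<in> D then M i else count_space {})"

lemma product_sigma_finite_factor: "product_sigma_finite factor"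
proof (rule product_sigma_finite.intro)
  fix i show "sigma_finite_measure (factor i)"
    unfolding factor_def using finite_factor
    by (auto intro: finite_measure.axioms(1) sigma_finite_measure_count_space_finite)
qed

lemma PiM_factor: "I \<subseteq> D \<Longrightarrow> Pi\<^sub>M I factor = Pi\<^sub>M I M"
  by (intro PiM_cong) (auto simp: factor_def)

lemma reference_measure_PiM:
  assumes I: "I \<subseteq> D" shows "reference_measure (Pi\<^sub>M I M)"
proof -
  interpret F: product_sigma_finite factor by (rule product_sigma_finite_factor)
  have fin: "finite I" using I finite_D by (rule finite_subset)
  have "emeasure (Pi\<^sub>M I factor) (Pi\<^sub>E I (\<lambda>i. space (factor i))) = (\<Prod>i\<in>I. emeasure (factor i) (space (factor i)))"
    by (intro F.emeasure_PiM fin) auto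
  also have "\<dots> = (\<Prod>i\<in>I. emeasure (M i) (space (M i)))"
    using I by (intro prod.cong) (auto simp: factor_def)
  finally have eq: "emeasure (Pi\<^sub>M I M) (space (Pi\<^sub>M I M)) = (\<Prod>i\<in>I. emeasure (M i) (space (M i)))"
    using PiM_factor[OF I] by (simp flip: space_PiM)
  show ?thesis
  proof (intro reference_measure.intro reference_measure_axioms.intro finite_measureI)
    show "emeasure (Pi\<^sub>M I M) (space (Pi\<^sub>M I M)) \<noteq> \<infinity>"
      unfolding eq using I finite_factor
      by (auto simp: ennreal_prod_eq_top finite_measure.emeasure_finite subset_iff)
    show "emeasure (Pi\<^sub>M I M) (space (Pi\<^sub>M I M)) \<noteq> 0"
      unfolding eq using I nonzero_factor fin by (auto simp: subset_iff)
  qed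
qed

abbreviation whole :: "('i \<Rightarrow> 'a) measure" where
  "whole \<equiv> Pi\<^sub>M D M"

sublocale whole: reference_measure "Pi\<^sub>M D M"
  by (rule reference_measure_PiM) simp

abbreviation glue :: "'i set \<Rightarrow> ('i \<Rightarrow> 'a) \<Rightarrow> ('i \<Rightarrow> 'a) \<Rightarrow> 'i \<Rightarrow> 'a" where
  "glue I x y \<equiv> merge I (D - I) (x, y)"

lemma glue_measurable:
  assumes "I \<subseteq> D"
  shows "merge I (D - I) \<in> Pi\<^sub>M I M \<Otimes>\<^sub>M Pi\<^sub>M (D - I) M \<rightarrow>\<^sub>M whole"
proof -
  have "I \<union> (D - I) = D" using assms by auto
  then show ?thesis using measurable_merge[of I "D - I" M] by simp
qed

lemma distr_glue:
  assumes I: "I \<subseteq> D"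
  shows "distr (Pi\<^sub>M I M \<Otimes>\<^sub>M Pi\<^sub>M (D - I) M) whole (merge I (D - I)) = whole"
proof -
  interpret F: product_sigma_finite factor by (rule product_sigma_finite_factor)
  have "I \<union> (D - I) = D" using I by auto
  then show ?thesis
    using F.distr_merge[of I "D - I"] finite_subset[OF I finite_D] finite_D
    by (simp add: PiM_factor I)
qed

lemma pair_sigma_finite_split:
  assumes I: "I \<subseteq> D" shows "pair_sigma_finite (Pi\<^sub>M I M) (Pi\<^sub>M (D - I) M)"
proof -
  interpret A: reference_measure "Pi\<^sub>M I M" by (rule reference_measure_PiM[OF I])
  interpret B: reference_measure "Pi\<^sub>M (D - I) M" by (rule reference_measure_PiM) auto
  show ?thesis by standard
qed

lemma case_prod_glue: "(\<lambda>(x, y). u (glue I x y)) = (\<lambda>z. u (merge I (D - I) z))"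
  by auto

lemma integrable_split:
  fixes u :: "('i \<Rightarrow> 'a) \<Rightarrow> real"
  assumes I: "I \<subseteq> D" and u: "integrable whole u"
  shows "integrable (Pi\<^sub>M I M \<Otimes>\<^sub>M Pi\<^sub>M (D - I) M) (\<lambda>(x, y). u (glue I x y))"
proof -
  have "integrable (distr (Pi\<^sub>M I M \<Otimes>\<^sub>M Pi\<^sub>M (D - I) M) whole (merge I (D - I))) u"
    using u by (simp add: distr_glue[OF I])
  then show ?thesis
    unfolding case_prod_glue
    by (subst (asm) integrable_distr_eq[OF glue_measurable[OF I]]) (use u in auto)
qed

lemma integral_split:
  fixes u :: "('i \<Rightarrow> 'a) \<Rightarrow> real"
  assumes I: "I \<subseteq> D" and u: "integrable whole u"
  shows "(\<integral>z. u z \<partial>whole) = (\<integral>x. (\<integral>y. u (glue I x y) \<partial>Pi\<^sub>M (D - I) M) \<partial>Pi\<^sub>M I M)"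
proof -
  interpret P: pair_sigma_finite "Pi\<^sub>M I M" "Pi\<^sub>M (D - I) M" by (rule pair_sigma_finite_split[OF I])
  have "(\<integral>z. u z \<partial>whole) = (\<integral>z. u z \<partial>distr (Pi\<^sub>M I M \<Otimes>\<^sub>M Pi\<^sub>M (D - I) M) whole (merge I (D - I)))"
    by (simp add: distr_glue[OF I])
  also have "\<dots> = (\<integral>z. u (merge I (D - I) z) \<partial>(Pi\<^sub>M I M \<Otimes>\<^sub>M Pi\<^sub>M (D - I) M))"
    using u by (intro integral_distr glue_measurable I) auto
  also have "\<dots> = (\<integral>x. (\<integral>y. u (glue I x y) \<partial>Pi\<^sub>M (D - I) M) \<partial>Pi\<^sub>M I M)"
    using P.integral_fst'[OF integrable_split[OF I u]] by (simp add: case_prod_glue)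
  finally show ?thesis .
qed

lemma glue_in_space:
  "I \<subseteq> D \<Longrightarrow> x \<in> space (Pi\<^sub>M I M) \<Longrightarrow> y \<in> space (Pi\<^sub>M (D - I) M) \<Longrightarrow> glue I x y \<in> space whole"
  using measurable_space[OF glue_measurable, of I "(x, y)"] by (simp add: space_pair_measure)

lemma restrict_in_space: "x \<in> space (Pi\<^sub>M I M) \<Longrightarrow> restrict x I = x"
  by (simp add: space_PiM)

lemma restrict_glue:
  "x \<in> space (Pi\<^sub>M I M) \<Longrightarrow> restrict (glue I x y) I = x"
  by (auto simp: space_PiM PiE_def extensional_def restrict_def merge_def)

text \<open>
  Forgetting the coordinates outside \<open>I\<close> maps \<open>\<lambda>\<close> to a constant multiple of \<open>\<lambda>\<^sub>I\<close>, so null sets and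
  integrability can be moved between \<open>\<lambda>\<^sub>I\<close> and \<open>\<lambda>\<close>.
\<close>

lemma distr_restrict:
  assumes I: "I \<subseteq> D"
  shows "distr whole (Pi\<^sub>M I M) (\<lambda>x. restrict x I) =
    density (Pi\<^sub>M I M) (\<lambda>_. ennreal (measure (Pi\<^sub>M (D - I) M) (space (Pi\<^sub>M (D - I) M))))"
    (is "?L = ?R")
proof (rule measure_eqI)
  interpret B: reference_measure "Pi\<^sub>M (D - I) M" by (rule reference_measure_PiM) auto
  have r: "(\<lambda>x. restrict x I) \<in> whole \<rightarrow>\<^sub>M Pi\<^sub>M I M"
    by (rule measurable_restrict_subset[OF I])
  fix A assume "A \<in> sets ?L"
  then have A: "A \<in> sets (Pi\<^sub>M I M)" by simp
  let ?S = "(\<lambda>x. restrict x I) -` A \<inter> space whole"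
  have S: "?S \<in> sets whole" using r A by (rule measurable_sets)
  have pre: "merge I (D - I) -` ?S \<inter> space (Pi\<^sub>M I M \<Otimes>\<^sub>M Pi\<^sub>M (D - I) M) = A \<times> space (Pi\<^sub>M (D - I) M)"
    using sets.sets_into_space[OF A]
    by (auto simp: space_pair_measure restrict_in_space glue_in_space[OF I] subset_iff)
  have "emeasure ?L A = emeasure whole ?S"
    by (rule emeasure_distr[OF r A])
  also have "\<dots> = emeasure (distr (Pi\<^sub>M I M \<Otimes>\<^sub>M Pi\<^sub>M (D - I) M) whole (merge I (D - I))) ?S"
    by (simp add: distr_glue[OF I])
  also have "\<dots> = emeasure (Pi\<^sub>M I M \<Otimes>\<^sub>M Pi\<^sub>M (D - I) M) (A \<times> space (Pi\<^sub>M (D - I) M))"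
    by (simp only: emeasure_distr[OF glue_measurable[OF I] S] pre)
  also have "\<dots> = emeasure (Pi\<^sub>M I M) A * emeasure (Pi\<^sub>M (D - I) M) (space (Pi\<^sub>M (D - I) M))"
    by (rule B.emeasure_pair_measure_Times[OF A]) simp
  also have "\<dots> = emeasure ?R A"
    using A by (simp add: emeasure_density nn_integral_cmult_indicator B.emeasure_eq_measure mult.commute[of "emeasure _ A"])
  finally show "emeasure ?L A = emeasure ?R A" .
qed simp

lemma AE_restrict_iff:
  assumes I: "I \<subseteq> D" and P: "{x \<in> space (Pi\<^sub>M I M). P x} \<in> sets (Pi\<^sub>M I M)"
  shows "(AE x in whole. P (restrict x I)) \<longleftrightarrow> (AE x in Pi\<^sub>M I M. P x)"
proof -
  interpret B: reference_measure "Pi\<^sub>M (D - I) M" by (rule reference_measure_PiM) auto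
  have "(AE x in whole. P (restrict x I)) \<longleftrightarrow> (AE x in distr whole (Pi\<^sub>M I M) (\<lambda>x. restrict x I). P x)"
    by (rule AE_distr_iff[symmetric, OF measurable_restrict_subset[OF I] P])
  also have "\<dots> \<longleftrightarrow> (AE x in Pi\<^sub>M I M. P x)"
    using B.total_mass_pos by (simp only: distr_restrict[OF I]) (simp add: AE_density)
  finally show ?thesis .
qed

lemma integrable_restrict_iff:
  fixes u :: "('i \<Rightarrow> 'a) \<Rightarrow> real"
  assumes I: "I \<subseteq> D" and u: "u \<in> borel_measurable (Pi\<^sub>M I M)"
  shows "integrable whole (\<lambda>x. u (restrict x I)) \<longleftrightarrow> integrable (Pi\<^sub>M I M) u"
proof -
  interpret B: reference_measure "Pi\<^sub>M (D - I) M" by (rule reference_measure_PiM) auto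
  have "integrable whole (\<lambda>x. u (restrict x I)) \<longleftrightarrow>
      integrable (distr whole (Pi\<^sub>M I M) (\<lambda>x. restrict x I)) u"
    by (rule integrable_distr_eq[symmetric, OF measurable_restrict_subset[OF I] u])
  also have "\<dots> \<longleftrightarrow> integrable (Pi\<^sub>M I M) u"
    using B.total_mass_pos u by (simp only: distr_restrict[OF I]) (simp add: integrable_density)
  finally show ?thesis .
qed

lemma B2_restrict_iff:
  assumes I: "I \<subseteq> D" and g: "g \<in> borel_measurable (Pi\<^sub>M I M)"
  shows "(\<lambda>x. g (restrict x I)) \<in> B2 whole \<longleftrightarrow> g \<in> B2 (Pi\<^sub>M I M)"
proof -
  interpret A: reference_measure "Pi\<^sub>M I M" by (rule reference_measure_PiM[OF I])
  note [measurable] = g measurable_restrict_subset[OF I]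
  show ?thesis
    unfolding A.B2_iff whole.B2_iff
    using AE_restrict_iff[OF I, of "\<lambda>x. 0 < g x"] integrable_restrict_iff[OF I, of "\<lambda>x. (ln (g x))\<^sup>2"]
    by simp
qed

section \<open>Densities depending on a subset of the coordinates\<close>

lemma B2_on_B2: "f \<in> B2_on M D I \<Longrightarrow> f \<in> B2 whole"
  by (simp add: B2_on_def)

lemma B2_on_restrict:
  assumes I: "I \<subseteq> D" and g: "g \<in> B2 (Pi\<^sub>M I M)"
  shows "(\<lambda>x. g (restrict x I)) \<in> B2_on M D I"
proof -
  interpret A: reference_measure "Pi\<^sub>M I M" by (rule reference_measure_PiM[OF I])
  show ?thesis
    using g B2_restrict_iff[OF I A.B2_measurable[OF g]]
    by (auto simp: B2_on_def intro: whole.bayes_eq_refl)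
qed

text \<open>
  A density whose values are determined by the coordinates in \<open>I\<close> factors through the restriction to
  \<open>I\<close>: the remaining coordinates can be filled with those of one fixed point. Such a point exists
  because the factors have positive mass.
\<close>

lemma B2_onI:
  assumes I: "I \<subseteq> D" and h: "h \<in> B2 whole"
    and dep: "\<And>x x'. x \<in> space whole \<Longrightarrow> x' \<in> space whole \<Longrightarrow> restrict x I = restrict x' I \<Longrightarrow> h x = h x'"
  shows "h \<in> B2_on M D I"
proof -
  interpret B: reference_measure "Pi\<^sub>M (D - I) M" by (rule reference_measure_PiM) auto
  have "space (Pi\<^sub>M (D - I) M) \<noteq> {}" using B.nonzero by (metis emeasure_empty)
  then obtain y where y: "y \<in> space (Pi\<^sub>M (D - I) M)" by blast
  define g where "g x = h (glue I x y)" for x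
  have [measurable]: "h \<in> borel_measurable whole" using h by (rule whole.B2_measurable)
  have "(\<lambda>x. (x, y)) \<in> Pi\<^sub>M I M \<rightarrow>\<^sub>M Pi\<^sub>M I M \<Otimes>\<^sub>M Pi\<^sub>M (D - I) M"
    using y by simp
  from measurable_compose[OF this glue_measurable[OF I]]
  have g: "g \<in> borel_measurable (Pi\<^sub>M I M)"
    unfolding g_def by measurable
  have eq: "h x = g (restrict x I)" if x: "x \<in> space whole" for x
  proof -
    have r: "restrict x I \<in> space (Pi\<^sub>M I M)"
      using measurable_space[OF measurable_restrict_subset[OF I] x] .
    show ?thesis
      unfolding g_def using x r y
      by (intro dep glue_in_space I) (simp_all only: restrict_glue)
  qed
  have "bayes_eq whole h (\<lambda>x. g (restrict x I))"
    by (rule whole.AE_bayes_eq) (auto simp: eq)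
  moreover have "(\<lambda>x. g (restrict x I)) \<in> B2 whole"
    using whole.bayes_eq_B2[OF h _ whole.bayes_eq_sym[OF \<open>bayes_eq whole h _\<close>]]
      measurable_compose[OF measurable_restrict_subset[OF I] g] by simp
  then have "g \<in> B2 (Pi\<^sub>M I M)" by (simp add: B2_restrict_iff[OF I g])
  ultimately show ?thesis using h by (auto simp: B2_on_def)
qed

lemma bayes_subspace_B2_on:
  assumes I: "I \<subseteq> D"
  shows "bayes_subspace whole (B2_on M D I)"
proof -
  interpret A: reference_measure "Pi\<^sub>M I M" by (rule reference_measure_PiM[OF I])
  have rep: "\<exists>g\<in>B2 (Pi\<^sub>M I M). bayes_eq whole f (\<lambda>x. g (restrict x I))" if "f \<in> B2_on M D I" for f
    using that by (auto simp: B2_on_def)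
  show ?thesis
    unfolding bayes_subspace_def
  proof (intro conjI ballI allI impI)
    show "B2_on M D I \<subseteq> B2 whole" by (simp add: B2_on_B2 subset_iff)
    show "(\<lambda>x. 1) \<in> B2_on M D I"
      by (rule B2_onI[OF I whole.B2_const]) auto
  next
    fix f g assume f: "f \<in> B2_on M D I" and g: "g \<in> bayes whole" and eq: "bayes_eq whole g f"
    have "g \<in> B2 whole"
      by (rule whole.bayes_eq_B2[OF B2_on_B2[OF f] bayes_measurable[OF g] eq])
    moreover obtain h where "h \<in> B2 (Pi\<^sub>M I M)" "bayes_eq whole f (\<lambda>x. h (restrict x I))"
      using rep[OF f] by blast
    ultimately show "g \<in> B2_on M D I"
      unfolding B2_on_def using whole.bayes_eq_trans[OF eq] by blast
  next
    fix f f' assume f: "f \<in> B2_on M D I" and f': "f' \<in> B2_on M D I"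
    obtain g g' where g: "g \<in> B2 (Pi\<^sub>M I M)" "bayes_eq whole f (\<lambda>x. g (restrict x I))"
      and g': "g' \<in> B2 (Pi\<^sub>M I M)" "bayes_eq whole f' (\<lambda>x. g' (restrict x I))"
      using rep[OF f] rep[OF f'] by blast
    have "bayes_eq whole (bayes_add f f') (\<lambda>x. bayes_add g g' (restrict x I))"
      using whole.bayes_eq_add[OF g(2) g'(2)] by (simp add: bayes_add_def)
    with A.bayes_add_B2[OF g(1) g'(1)] whole.bayes_add_B2[OF B2_on_B2[OF f] B2_on_B2[OF f']]
    show "bayes_add f f' \<in> B2_on M D I" by (auto simp: B2_on_def)
  next
    fix f a assume f: "f \<in> B2_on M D I"
    obtain g where g: "g \<in> B2 (Pi\<^sub>M I M)" "bayes_eq whole f (\<lambda>x. g (restrict x I))"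
      using rep[OF f] by blast
    have "bayes_eq whole (bayes_scale a f) (\<lambda>x. bayes_scale a g (restrict x I))"
      using whole.bayes_eq_scale[OF B2_on_B2[OF B2_on_restrict[OF I g(1)]] g(2)]
      by (simp add: bayes_scale_def)
    with A.bayes_scale_B2[OF g(1)] whole.bayes_scale_B2[OF B2_on_B2[OF f]]
    show "bayes_scale a f \<in> B2_on M D I" by (auto simp: B2_on_def)
  qed
qed

lemma B2_on_mono:
  assumes "I \<subseteq> J" "J \<subseteq> D" shows "B2_on M D I \<subseteq> B2_on M D J"
proof
  have I: "I \<subseteq> D" using assms by auto
  fix f assume f: "f \<in> B2_on M D I"
  then obtain g where g: "g \<in> B2 (Pi\<^sub>M I M)" and eq: "bayes_eq whole f (\<lambda>x. g (restrict x I))"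
    by (auto simp: B2_on_def)
  have "(\<lambda>x. g (restrict x I)) \<in> B2_on M D J"
  proof (rule B2_onI[OF assms(2) B2_on_B2[OF B2_on_restrict[OF I g]]])
    fix x x' :: "'i \<Rightarrow> 'a" assume "restrict x J = restrict x' J"
    then have "restrict (restrict x J) I = restrict (restrict x' J) I" by simp
    then show "g (restrict x I) = g (restrict x' I)"
      using assms(1) by (simp add: Int_absorb1)
  qed
  then show "f \<in> B2_on M D J"
    using whole.subspace_cong[OF bayes_subspace_B2_on[OF assms(2)] _ whole.B2_bayes[OF B2_on_B2[OF f]] eq]
    by blast
qed

lemma B2_on_whole: "B2_on M D D = B2 whole"
proof
  show "B2 whole \<subseteq> B2_on M D D"
  proof
    fix f assume "f \<in> B2 whole"
    then show "f \<in> B2_on M D D"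
      by (rule B2_onI[OF order_refl]) (simp add: restrict_in_space)
  qed
qed (simp add: B2_on_B2 subset_iff)

section \<open>Geometric margins as orthogonal projections\<close>

text \<open>
  What has to be shown is that averaging preserves square integrability. By Cauchy-Schwarz the square
  of the averaged log-density is bounded by the average of its square, which is integrable by Fubini.
\<close>

lemma geom_margin_in_B2_on:
  assumes f: "f \<in> B2 whole" and I: "I \<subseteq> D"
  shows "geom_margin M D f I \<in> B2_on M D I"
proof (cases "I = D")
  case True
  then show ?thesis using f by (simp add: geom_margin_def B2_on_whole)
next
  case False
  interpret A: reference_measure "Pi\<^sub>M I M" by (rule reference_measure_PiM[OF I])
  interpret B: reference_measure "Pi\<^sub>M (D - I) M" by (rule reference_measure_PiM) auto
  interpret P: pair_sigma_finite "Pi\<^sub>M I M" "Pi\<^sub>M (D - I) M" by (rule pair_sigma_finite_split[OF I])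
  note [measurable] = whole.B2_measurable[OF f] glue_measurable[OF I]
  define u where "u x y = ln (f (glue I x y))" for x y
  have u [measurable]: "case_prod u \<in> borel_measurable (Pi\<^sub>M I M \<Otimes>\<^sub>M Pi\<^sub>M (D - I) M)"
    unfolding u_def by measurable
  have sq: "integrable (Pi\<^sub>M I M \<Otimes>\<^sub>M Pi\<^sub>M (D - I) M) (\<lambda>(x, y). (u x y)\<^sup>2)"
    unfolding u_def by (rule integrable_split[OF I whole.B2_square_integrable[OF f]])
  define U where "U x = (\<integral>y. u x y \<partial>Pi\<^sub>M (D - I) M)" for x
  have U [measurable]: "U \<in> borel_measurable (Pi\<^sub>M I M)"
    unfolding U_def by measurable
  have "integrable (Pi\<^sub>M I M) (\<lambda>x. (U x)\<^sup>2)"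
  proof (rule Bochner_Integration.integrable_bound)
    show "integrable (Pi\<^sub>M I M) (\<lambda>x. B.total_mass * (\<integral>y. (u x y)\<^sup>2 \<partial>Pi\<^sub>M (D - I) M))"
      using P.integrable_fst'[OF sq] by simp
    have "AE x in Pi\<^sub>M I M. integrable (Pi\<^sub>M (D - I) M) (\<lambda>y. (u x y)\<^sup>2)"
      using P.AE_integrable_fst'[OF sq] by simp
    then show "AE x in Pi\<^sub>M I M. norm ((U x)\<^sup>2) \<le>
        norm (B.total_mass * (\<integral>y. (u x y)\<^sup>2 \<partial>Pi\<^sub>M (D - I) M))"
    proof (rule AE_mp, intro AE_I2 impI)
      fix x assume x: "x \<in> space (Pi\<^sub>M I M)" and "integrable (Pi\<^sub>M (D - I) M) (\<lambda>y. (u x y)\<^sup>2)"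
      then have "(U x)\<^sup>2 \<le> B.total_mass * (\<integral>y. (u x y)\<^sup>2 \<partial>Pi\<^sub>M (D - I) M)"
        unfolding U_def by (intro B.square_integral_le) measurable
      then show "norm ((U x)\<^sup>2) \<le> norm (B.total_mass * (\<integral>y. (u x y)\<^sup>2 \<partial>Pi\<^sub>M (D - I) M))"
        by simp
    qed
  qed measurable
  then have "(\<lambda>x. exp (1 / B.total_mass * U x)) \<in> B2 (Pi\<^sub>M I M)"
    unfolding A.B2_iff by (auto simp: power_divide)
  moreover have "geom_margin M D f I = (\<lambda>x. exp (1 / B.total_mass * U (restrict x I)))"
    using False by (auto simp: geom_margin_def U_def u_def merge_def fun_eq_iff cong: if_cong)
  ultimately show ?thesis
    using B2_on_restrict[OF I] by simp
qed

lemma geom_margin_B2: "f \<in> B2 whole \<Longrightarrow> I \<subseteq> D \<Longrightarrow> geom_margin M D f I \<in> B2 whole"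
  by (rule B2_on_B2[OF geom_margin_in_B2_on])

text \<open>
  The factor \<open>g\<close> is constant along the coordinates over which the margin averages, so both integrals
  reduce to the integral of \<open>U * ln g\<close> over \<open>\<Omega>\<^sub>I\<close>, where \<open>U\<close> is the inner integral of \<open>ln f\<close>.
\<close>

lemma integral_geom_margin_mult:
  assumes f: "f \<in> B2 whole" and I: "I \<subseteq> D" and g: "g \<in> B2 (Pi\<^sub>M I M)"
  shows "(\<integral>z. ln (geom_margin M D f I z) * ln (g (restrict z I)) \<partial>whole) =
    (\<integral>z. ln (f z) * ln (g (restrict z I)) \<partial>whole)"
proof (cases "I = D")
  case True
  then show ?thesis by (simp add: geom_margin_def)
next
  case False
  interpret B: reference_measure "Pi\<^sub>M (D - I) M" by (rule reference_measure_PiM) auto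
  have gr: "(\<lambda>x. g (restrict x I)) \<in> B2 whole" by (rule B2_on_B2[OF B2_on_restrict[OF I g]])
  define U where "U x = (\<integral>y. ln (f (glue I x y)) \<partial>Pi\<^sub>M (D - I) M)" for x
  have marg: "ln (geom_margin M D f I (glue I x y)) = U x / B.total_mass"
    if "x \<in> space (Pi\<^sub>M I M)" for x y
  proof -
    have "glue I (glue I x y) y' = glue I x y'" for y'
      by (auto simp: merge_def)
    then show ?thesis using False by (simp add: geom_margin_def U_def)
  qed
  have "(\<integral>z. ln (geom_margin M D f I z) * ln (g (restrict z I)) \<partial>whole) =
      (\<integral>x. (\<integral>y. ln (geom_margin M D f I (glue I x y)) * ln (g (restrict (glue I x y) I))
        \<partial>Pi\<^sub>M (D - I) M) \<partial>Pi\<^sub>M I M)"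
    by (intro integral_split I whole.B2_integrable_mult geom_margin_B2 f gr)
  also have "\<dots> = (\<integral>x. U x * ln (g x) \<partial>Pi\<^sub>M I M)"
    using B.total_mass_pos
    by (intro Bochner_Integration.integral_cong refl) (simp add: marg restrict_glue restrict_in_space)
  also have "\<dots> = (\<integral>x. (\<integral>y. ln (f (glue I x y)) * ln (g (restrict (glue I x y) I))
        \<partial>Pi\<^sub>M (D - I) M) \<partial>Pi\<^sub>M I M)"
    by (intro Bochner_Integration.integral_cong refl) (simp add: restrict_glue restrict_in_space U_def)
  also have "\<dots> = (\<integral>z. ln (f z) * ln (g (restrict z I)) \<partial>whole)"
    by (intro integral_split[symmetric] I whole.B2_integrable_mult f gr)
  finally show ?thesis .
qed

text \<open>
  Together with \<open>geom_margin_in_B2_on\<close> this characterises the geometric margin as the orthogonal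
  projection onto \<open>B2_on M D I\<close>. For the covariance, the previous lemma is used twice: with \<open>g\<close> itself
  and with the constant \<open>exp 1\<close>, whose logarithm is \<open>1\<close>, to compare the means.
\<close>

lemma inner_geom_margin:
  assumes f: "f \<in> B2 whole" and I: "I \<subseteq> D" and g: "g \<in> B2_on M D I"
  shows "bayes_inner whole (geom_margin M D f I) g = bayes_inner whole f g"
proof -
  interpret A: reference_measure "Pi\<^sub>M I M" by (rule reference_measure_PiM[OF I])
  obtain h where h: "h \<in> B2 (Pi\<^sub>M I M)" and eq: "bayes_eq whole g (\<lambda>x. h (restrict x I))"
    using g by (auto simp: B2_on_def)
  let ?h = "\<lambda>x. h (restrict x I)" and ?f = "geom_margin M D f I"
  have hr: "?h \<in> B2 whole" by (rule B2_on_B2[OF B2_on_restrict[OF I h]])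
  have f': "?f \<in> B2 whole" by (rule geom_margin_B2[OF f I])
  have "bayes_inner whole ?f ?h = bayes_inner whole f ?h"
    using integral_geom_margin_mult[OF f I h]
      integral_geom_margin_mult[OF f I A.B2_const[of "exp 1"]]
    by (simp add: whole.bayes_inner_eq_covariance f f' hr)
  moreover have "bayes_inner whole k g = bayes_inner whole k ?h" if "k \<in> B2 whole" for k
    using whole.bayes_inner_cong_left[OF B2_on_B2[OF g] that hr eq]
      whole.bayes_inner_commute that hr B2_on_B2[OF g] by metis
  ultimately show ?thesis using f f' by simp
qed

lemma geom_margin_cong:
  assumes f: "f \<in> B2 whole" and g: "g \<in> B2 whole" and I: "I \<subseteq> D" and eq: "bayes_eq whole f g"
  shows "bayes_eq whole (geom_margin M D f I) (geom_margin M D g I)"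
proof (rule whole.eq_if_inner_eq[OF bayes_subspace_B2_on[OF I]])
  fix h assume h: "h \<in> B2_on M D I"
  show "bayes_inner whole (geom_margin M D f I) h = bayes_inner whole (geom_margin M D g I) h"
    using whole.bayes_inner_cong_left[OF f B2_on_B2[OF h] g eq]
    by (simp add: inner_geom_margin f g I h)
qed (simp_all add: geom_margin_in_B2_on f g I)

text \<open>
  If the dependence on the coordinates in \<open>K\<close> holds everywhere, and not just almost everywhere, then
  two points that agree on \<open>I \<inter> K\<close> lead to the same integrand in the margin. The general case follows
  because the margin, being a projection, respects \<open>\<propto>\<close>.
\<close>

lemma geom_margin_in_B2_on_Int:
  assumes f: "f \<in> B2_on M D K" and K: "K \<subseteq> D" and I: "I \<subseteq> D"
  shows "geom_margin M D f I \<in> B2_on M D (I \<inter> K)"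
proof (cases "I = D")
  case True
  then show ?thesis using f K by (simp add: geom_margin_def Int_absorb1)
next
  case False
  obtain h where h: "h \<in> B2 (Pi\<^sub>M K M)" and eq: "bayes_eq whole f (\<lambda>x. h (restrict x K))"
    using f by (auto simp: B2_on_def)
  let ?h = "\<lambda>x. h (restrict x K)"
  have hr: "?h \<in> B2 whole" by (rule B2_on_B2[OF B2_on_restrict[OF K h]])
  have IK: "I \<inter> K \<subseteq> D" using I by auto
  have "geom_margin M D ?h I \<in> B2_on M D (I \<inter> K)"
  proof (rule B2_onI[OF IK geom_margin_B2[OF hr I]])
    fix x x' :: "'i \<Rightarrow> 'a" assume "restrict x (I \<inter> K) = restrict x' (I \<inter> K)"
    then have "x i = x' i" if "i \<in> I" "i \<in> K" for i
      using that by (metis IntI restrict_apply')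
    then have "restrict (glue I x y) K = restrict (glue I x' y) K" for y
      by (auto simp: merge_def restrict_def)
    then show "geom_margin M D ?h I x = geom_margin M D ?h I x'"
      using False by (simp add: geom_margin_def)
  qed
  then show ?thesis
    using whole.subspace_cong[OF bayes_subspace_B2_on[OF IK]]
      geom_margin_cong[OF B2_on_B2[OF f] hr I eq]
      whole.B2_bayes[OF geom_margin_B2[OF B2_on_B2[OF f] I]] by blast
qed

lemma finite_nonempty_subsets: "I \<subseteq> D \<Longrightarrow> finite {J. J \<noteq> {} \<and> J \<subseteq> I}"
  by (rule finite_subset[of _ "Pow D"]) (use finite_D in auto)

text \<open>
  A density of no coordinates is a constant, the neutral element. Thanks to this, the empty set can
  take part in the alternating sums below, although the interaction parts omit it.
\<close>

lemma inner_B2_on_empty: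
  assumes f: "f \<in> B2_on M D {}" and h: "h \<in> B2 whole"
  shows "bayes_inner whole f h = 0"
proof -
  obtain g where g: "g \<in> B2 (Pi\<^sub>M {} M)" and eq: "bayes_eq whole f (\<lambda>x. g (restrict x {}))"
    using f by (auto simp: B2_on_def)
  have c: "(\<lambda>x. g (restrict x {})) = (\<lambda>x. g (\<lambda>_. undefined))" by (simp add: restrict_def)
  have "(\<lambda>x. g (restrict x {})) \<in> B2 whole"
    by (rule B2_on_B2[OF B2_on_restrict[OF _ g]]) simp
  then have "(\<lambda>x. g (\<lambda>_. undefined)) \<in> B2 whole" unfolding c .
  then show ?thesis
    using whole.bayes_inner_cong_left[OF B2_on_B2[OF f] h _ eq[unfolded c]]
      whole.bayes_inner_const_left h by simp
qed

lemma geom_margin_fixes_B2_on: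
  assumes f: "f \<in> B2_on M D I" and I: "I \<subseteq> D"
  shows "bayes_eq whole f (geom_margin M D f I)"
  by (rule whole.eq_if_inner_eq[OF bayes_subspace_B2_on[OF I] f])
    (simp_all add: inner_geom_margin geom_margin_in_B2_on B2_on_B2[OF f] I)

text \<open>
  Projections are self-adjoint, so the margin can be moved from \<open>f\<close> to \<open>v\<close>. The margin of \<open>v\<close> over \<open>J\<close>
  depends on the coordinates in \<open>J \<inter> K\<close> only, and so it agrees with the margin over \<open>J \<inter> K\<close>.
\<close>

lemma inner_geom_margin_swap:
  assumes f: "f \<in> B2 whole" and J: "J \<subseteq> D" and K: "K \<subseteq> D" and v: "v \<in> B2_on M D K"
  shows "bayes_inner whole (geom_margin M D f J) v = bayes_inner whole (geom_margin M D v (J \<inter> K)) f"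
proof -
  note vB = B2_on_B2[OF v]
  have JK: "J \<inter> K \<subseteq> D" using J by auto
  note mB = geom_margin_B2[OF f J] geom_margin_B2[OF vB J] geom_margin_B2[OF vB JK]
  have eq: "bayes_eq whole (geom_margin M D v J) (geom_margin M D v (J \<inter> K))"
  proof (rule whole.eq_if_inner_eq[OF bayes_subspace_B2_on[OF JK]])
    show "geom_margin M D v J \<in> B2_on M D (J \<inter> K)"
      by (rule geom_margin_in_B2_on_Int[OF v K J])
    show "geom_margin M D v (J \<inter> K) \<in> B2_on M D (J \<inter> K)"
      by (rule geom_margin_in_B2_on[OF vB JK])
    fix h assume h: "h \<in> B2_on M D (J \<inter> K)"
    then have "h \<in> B2_on M D J" using B2_on_mono[of "J \<inter> K" J] J by blast
    with h show "bayes_inner whole (geom_margin M D v J) h = bayes_inner whole (geom_margin M D v (J \<inter> K)) h"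
      by (simp add: inner_geom_margin vB J JK)
  qed
  have "bayes_inner whole (geom_margin M D f J) v = bayes_inner whole v (geom_margin M D f J)"
    by (rule whole.bayes_inner_commute[OF mB(1) vB])
  also have "\<dots> = bayes_inner whole (geom_margin M D v J) (geom_margin M D f J)"
    by (rule inner_geom_margin[symmetric, OF vB J geom_margin_in_B2_on[OF f J]])
  also have "\<dots> = bayes_inner whole (geom_margin M D f J) (geom_margin M D v J)"
    by (rule whole.bayes_inner_commute[OF mB(2,1)])
  also have "\<dots> = bayes_inner whole f (geom_margin M D v J)"
    by (rule inner_geom_margin[OF f J geom_margin_in_B2_on[OF vB J]])
  also have "\<dots> = bayes_inner whole (geom_margin M D v J) f"
    by (rule whole.bayes_inner_commute[OF f mB(2)])
  also have "\<dots> = bayes_inner whole (geom_margin M D v (J \<inter> K)) f"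
    by (rule whole.bayes_inner_cong_left[OF mB(2) f mB(3) eq])
  finally show ?thesis .
qed

section \<open>Interaction parts\<close>

lemma interaction_part_in_B2_on:
  assumes f: "f \<in> B2 whole" and I: "I \<subseteq> D"
  shows "interaction_part M D f I \<in> B2_on M D I"
  unfolding interaction_part_def
proof (intro whole.subspace_bigadd[OF bayes_subspace_B2_on[OF I] finite_nonempty_subsets[OF I]]
    whole.subspace_scale[OF bayes_subspace_B2_on[OF I]])
  fix J assume "J \<in> {J. J \<noteq> {} \<and> J \<subseteq> I}"
  then have "J \<subseteq> D" "J \<subseteq> I" using I by auto
  then show "geom_margin M D f J \<in> B2_on M D I"
    using geom_margin_in_B2_on[OF f] B2_on_mono[OF _ I] by blast
qed

lemma interaction_part_B2:
  "f \<in> B2 whole \<Longrightarrow> I \<subseteq> D \<Longrightarrow> interaction_part M D f I \<in> B2 whole"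
  by (rule B2_on_B2[OF interaction_part_in_B2_on])

lemma inner_interaction_part:
  assumes f: "f \<in> B2 whole" and I: "I \<subseteq> D" and h: "h \<in> B2 whole"
  shows "bayes_inner whole (interaction_part M D f I) h =
    (\<Sum>J\<in>Pow I. (-1) ^ card (I - J) * bayes_inner whole (geom_margin M D f J) h)"
proof -
  have m: "geom_margin M D f J \<in> B2 whole" if "J \<subseteq> I" for J
    using geom_margin_B2[OF f] that I by blast
  have "bayes_inner whole (interaction_part M D f I) h =
      (\<Sum>J\<in>{J. J \<noteq> {} \<and> J \<subseteq> I}. bayes_inner whole (bayes_scale ((-1) ^ card (I - J)) (geom_margin M D f J)) h)"
    unfolding interaction_part_def
    by (rule whole.bayes_inner_bigadd_left[OF finite_nonempty_subsets[OF I] _ h])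
      (auto intro: whole.bayes_scale_B2 m)
  also have "\<dots> = (\<Sum>J\<in>{J. J \<noteq> {} \<and> J \<subseteq> I}. (-1) ^ card (I - J) * bayes_inner whole (geom_margin M D f J) h)"
    by (intro sum.cong refl whole.bayes_inner_scale_left h m) auto
  also have "\<dots> = (\<Sum>J\<in>Pow I. (-1) ^ card (I - J) * bayes_inner whole (geom_margin M D f J) h)"
  proof (rule sum.mono_neutral_left)
    show "finite (Pow I)" using I finite_D finite_subset by auto
    show "\<forall>J\<in>Pow I - {J. J \<noteq> {} \<and> J \<subseteq> I}. (-1) ^ card (I - J) * bayes_inner whole (geom_margin M D f J) h = 0"
      using inner_B2_on_empty[OF geom_margin_in_B2_on[OF f] h] by auto
  qed auto
  finally show ?thesis .
qed

text \<open>
  An index \<open>i\<close> in \<open>I - K\<close> does not affect \<open>J \<inter> K\<close>, so by \<open>inner_geom_margin_swap\<close> the margins over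
  \<open>J\<close> and \<open>insert i J\<close> have the same inner product with \<open>v\<close> and cancel.
\<close>

lemma interaction_part_orthogonal:
  assumes f: "f \<in> B2 whole" and I: "I \<subseteq> D" and K: "K \<subseteq> D" and v: "v \<in> B2_on M D K"
    and nsub: "\<not> I \<subseteq> K"
  shows "bayes_inner whole (interaction_part M D f I) v = 0"
proof -
  obtain i where i: "i \<in> I" "i \<notin> K" using nsub by blast
  have "bayes_inner whole (geom_margin M D f (insert i J)) v = bayes_inner whole (geom_margin M D f J) v"
    if "J \<subseteq> I" for J
  proof -
    have "J \<subseteq> D" "insert i J \<subseteq> D" using that i(1) I by auto
    moreover have "insert i J \<inter> K = J \<inter> K" using i(2) by auto
    ultimately show ?thesis
      using inner_geom_margin_swap[OF f _ K v] by metis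
  qed
  then show ?thesis
    unfolding inner_interaction_part[OF f I B2_on_B2[OF v]]
    using finite_subset[OF I finite_D] i(1) by (intro alternating_sum_toggle)
qed

text \<open>
  Moebius inversion for the logarithms of the margins, at every point where all margins are positive.
\<close>

lemma geom_margin_eq_bigadd_interaction_parts:
  assumes f: "f \<in> B2 whole" and I: "I \<subseteq> D" "I \<noteq> {}"
  shows "bayes_eq whole (geom_margin M D f I)
    (bayes_bigadd {J. J \<noteq> {} \<and> J \<subseteq> I} (interaction_part M D f))"
proof (rule whole.AE_bayes_eq)
  let ?N = "{J. J \<noteq> {} \<and> J \<subseteq> I}"
  have "AE x in whole. \<forall>K\<in>?N. 0 < geom_margin M D f K x"
    using geom_margin_B2[OF f] I
    by (intro AE_finite_allI finite_nonempty_subsets) (auto intro!: whole.B2_pos)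
  then show "AE x in whole. geom_margin M D f I x = bayes_bigadd ?N (interaction_part M D f) x"
  proof eventually_elim
    fix x assume pos: "\<forall>K\<in>?N. 0 < geom_margin M D f K x"
    define a where "a K = ln (geom_margin M D f K x)" for K
    have part: "interaction_part M D f J x = exp (\<Sum>K\<in>{K. K \<noteq> {} \<and> K \<subseteq> J}. (-1) ^ card (J - K) * a K)"
      if J: "J \<in> ?N" for J
    proof -
      have "interaction_part M D f J x = (\<Prod>K\<in>{K. K \<noteq> {} \<and> K \<subseteq> J}. exp ((-1) ^ card (J - K) * a K))"
        unfolding interaction_part_def bayes_bigadd_def bayes_scale_def
      proof (rule prod.cong[OF refl])
        fix K assume "K \<in> {K. K \<noteq> {} \<and> K \<subseteq> J}"
        then have "0 < geom_margin M D f K x" using pos J by auto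
        then show "geom_margin M D f K x powr (- 1) ^ card (J - K) = exp ((-1) ^ card (J - K) * a K)"
          by (simp add: powr_def a_def)
      qed
      moreover have "J \<subseteq> D" using J I by auto
      ultimately show ?thesis
        by (simp only: exp_sum[OF finite_nonempty_subsets])
    qed
    have "bayes_bigadd ?N (interaction_part M D f) x =
        exp (\<Sum>J\<in>?N. \<Sum>K\<in>{K. K \<noteq> {} \<and> K \<subseteq> J}. (-1) ^ card (J - K) * a K)"
      unfolding bayes_bigadd_def exp_sum[OF finite_nonempty_subsets[OF I(1)]]
      by (intro prod.cong refl part)
    also have "\<dots> = exp (a I)"
      using Moebius_inversion_subsets[OF finite_subset[OF I(1) finite_D] I(2)] by simp
    also have "\<dots> = geom_margin M D f I x" using pos I(2) by (simp add: a_def)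
    finally show "geom_margin M D f I x = bayes_bigadd ?N (interaction_part M D f) x" by simp
  qed
qed

lemma B2_on_eq_bigadd_interaction_parts:
  assumes f: "f \<in> B2_on M D I" and I: "I \<subseteq> D" "I \<noteq> {}"
  shows "bayes_eq whole f (bayes_bigadd {J. J \<noteq> {} \<and> J \<subseteq> I} (interaction_part M D f))"
  using whole.bayes_eq_trans[OF geom_margin_fixes_B2_on[OF f I(1)]
      geom_margin_eq_bigadd_interaction_parts[OF B2_on_B2[OF f] I]] .

section \<open>Interaction spaces and the orthogonal decomposition\<close>

text \<open>
  A non-recursive substitute for the interaction spaces, in which orthogonality is demanded against the
  full spaces of densities of fewer coordinates, to which margins apply. For a singleton \<open>I\<close> it
  is all of \<open>B2_on M D I\<close>, so it covers the main effects and the interactions uniformly.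
\<close>

definition pure_space :: "'i set \<Rightarrow> (('i \<Rightarrow> 'a) \<Rightarrow> real) set" where
  "pure_space I = {f \<in> B2_on M D I. \<forall>g\<in>\<Union>(B2_on M D ` {J. J \<noteq> {} \<and> J \<subset> I}). bayes_inner whole f g = 0}"

lemma pure_space_iff:
  "f \<in> pure_space I \<longleftrightarrow> f \<in> B2_on M D I \<and>
     (\<forall>J g. J \<noteq> {} \<longrightarrow> J \<subset> I \<longrightarrow> g \<in> B2_on M D J \<longrightarrow> bayes_inner whole f g = 0)"
  unfolding pure_space_def by blast

lemma bayes_subspace_pure_space:
  assumes I: "I \<subseteq> D" shows "bayes_subspace whole (pure_space I)"
  unfolding pure_space_def
proof (rule whole.bayes_subspace_orthogonal_complement[OF bayes_subspace_B2_on[OF I]], rule subsetI)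
  fix g assume "g \<in> \<Union>(B2_on M D ` {J. J \<noteq> {} \<and> J \<subset> I})"
  then obtain J where "g \<in> B2_on M D J" by blast
  then show "g \<in> B2 whole" by (rule B2_on_B2)
qed

lemma pure_space_B2_on: "f \<in> pure_space I \<Longrightarrow> f \<in> B2_on M D I"
  by (simp add: pure_space_def)

lemma pure_space_B2: "f \<in> pure_space I \<Longrightarrow> f \<in> B2 whole"
  by (rule B2_on_B2[OF pure_space_B2_on])

lemma interaction_part_in_pure_space:
  assumes f: "f \<in> B2 whole" and I: "I \<subseteq> D"
  shows "interaction_part M D f I \<in> pure_space I"
proof -
  have "bayes_inner whole (interaction_part M D f I) g = 0" if "g \<in> B2_on M D J" "J \<subset> I" for g J
  proof (rule interaction_part_orthogonal[OF f I _ that(1)])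
    show "J \<subseteq> D" "\<not> I \<subseteq> J" using that(2) I by auto
  qed
  then show ?thesis
    by (simp add: pure_space_iff interaction_part_in_B2_on[OF f I])
qed

text \<open>
  Replacing \<open>v\<close> by its margin over \<open>I\<close> does not change the inner product with \<open>f\<close>. That margin depends
  on the coordinates in \<open>I \<inter> K\<close>, a proper subset of \<open>I\<close>.
\<close>

lemma pure_space_orthogonal_B2_on:
  assumes f: "f \<in> pure_space I" and I: "I \<subseteq> D" and K: "K \<subseteq> D" and v: "v \<in> B2_on M D K"
    and nsub: "\<not> I \<subseteq> K"
  shows "bayes_inner whole f v = 0"
proof -
  note fB = pure_space_B2[OF f] and vB = B2_on_B2[OF v]
  let ?m = "geom_margin M D v I"
  have m: "?m \<in> B2_on M D (I \<inter> K)" by (rule geom_margin_in_B2_on_Int[OF v K I])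
  have "bayes_inner whole f v = bayes_inner whole v f"
    by (rule whole.bayes_inner_commute[OF fB vB])
  also have "\<dots> = bayes_inner whole ?m f"
    by (rule inner_geom_margin[symmetric, OF vB I pure_space_B2_on[OF f]])
  also have "\<dots> = 0"
  proof (cases "I \<inter> K = {}")
    case True
    then show ?thesis using m inner_B2_on_empty[OF _ fB] by simp
  next
    case False
    have "I \<inter> K \<subset> I" using nsub by auto
    with f[unfolded pure_space_iff] have "bayes_inner whole f ?m = 0"
      using False m by simp
    then show ?thesis using whole.bayes_inner_commute[OF B2_on_B2[OF m] fB] by simp
  qed
  finally show ?thesis .
qed

lemma pure_spaces_orthogonal:
  assumes "I \<subseteq> D" "J \<subseteq> D" "I \<noteq> J"
  shows "bayes_orthogonal whole (pure_space I) (pure_space J)"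
  unfolding bayes_orthogonal_def
proof (intro ballI)
  fix f g assume f: "f \<in> pure_space I" and g: "g \<in> pure_space J"
  consider "\<not> I \<subseteq> J" | "\<not> J \<subseteq> I" using assms(3) by auto
  then show "bayes_inner whole f g = 0"
  proof cases
    case 1
    then show ?thesis
      by (rule pure_space_orthogonal_B2_on[OF f assms(1,2) pure_space_B2_on[OF g]])
  next
    case 2
    then have "bayes_inner whole g f = 0"
      by (rule pure_space_orthogonal_B2_on[OF g assms(2,1) pure_space_B2_on[OF f]])
    then show ?thesis
      by (simp add: whole.bayes_inner_commute[OF pure_space_B2[OF f] pure_space_B2[OF g]])
  qed
qed

text \<open>
  The pure spaces below \<open>I\<close> have the same orthogonal complement in \<open>B2_on M D I\<close> as the larger spaces
  \<open>B2_on M D J\<close>, because each density in \<open>B2_on M D J\<close> is the sum of its interaction parts over the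
  subsets of \<open>J\<close>.
\<close>

lemma orthogonal_to_pure_sum_iff:
  assumes I: "I \<subseteq> D" and f: "f \<in> B2_on M D I"
  shows "(\<forall>g\<in>bayes_sum_space whole {J. J \<noteq> {} \<and> J \<subset> I} pure_space. bayes_inner whole f g = 0) \<longleftrightarrow>
    f \<in> pure_space I"
proof -
  let ?K = "{J. J \<noteq> {} \<and> J \<subset> I}"
  note fB = B2_on_B2[OF f]
  have fin: "finite ?K"
    by (rule finite_subset[OF _ finite_nonempty_subsets[OF I]]) auto
  show ?thesis
  proof
    assume orth: "\<forall>g\<in>bayes_sum_space whole ?K pure_space. bayes_inner whole f g = 0"
    have "bayes_inner whole f g = 0" if J: "J \<in> ?K" and g: "g \<in> B2_on M D J" for g J
    proof -
      have JD: "J \<subseteq> D" using J I by auto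
      \<comment> \<open>The interaction parts of \<open>g\<close> over subsets of \<open>J\<close>, padded with the neutral element.\<close>
      define w where "w K = (if K \<subseteq> J then interaction_part M D g K else (\<lambda>x. 1))" for K
      have "w K \<in> pure_space K" if "K \<in> ?K" for K
        using that I interaction_part_in_pure_space[OF B2_on_B2[OF g]]
          whole.subspace_one[OF bayes_subspace_pure_space]
        by (auto simp: w_def)
      moreover have "bayes_bigadd ?K w = bayes_bigadd {K. K \<noteq> {} \<and> K \<subseteq> J} (interaction_part M D g)"
        unfolding bayes_bigadd_def
        using J fin by (intro ext prod.mono_neutral_cong_right) (auto simp: w_def)
      then have "bayes_eq whole g (bayes_bigadd ?K w)"
        using B2_on_eq_bigadd_interaction_parts[OF g JD] J by simp
      ultimately have "g \<in> bayes_sum_space whole ?K pure_space"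
        unfolding bayes_sum_space_def using whole.B2_bayes[OF B2_on_B2[OF g]] by blast
      then show ?thesis using orth by blast
    qed
    then show "f \<in> pure_space I" using f by (simp add: pure_space_iff)
  next
    assume fp: "f \<in> pure_space I"
    show "\<forall>g\<in>bayes_sum_space whole ?K pure_space. bayes_inner whole f g = 0"
    proof
      fix g assume "g \<in> bayes_sum_space whole ?K pure_space"
      then obtain w where g: "g \<in> bayes whole" and w: "\<forall>k\<in>?K. w k \<in> pure_space k"
        and eq: "bayes_eq whole g (bayes_bigadd ?K w)"
        unfolding bayes_sum_space_def by blast
      have wB: "w k \<in> B2 whole" if "k \<in> ?K" for k using w that pure_space_B2 by blast
      have bigB: "bayes_bigadd ?K w \<in> B2 whole" by (rule whole.bayes_bigadd_B2[OF fin wB])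
      have gB: "g \<in> B2 whole"
        by (rule whole.bayes_eq_B2[OF bigB bayes_measurable[OF g] eq])
      have "bayes_inner whole f g = bayes_inner whole g f"
        by (rule whole.bayes_inner_commute[OF fB gB])
      also have "\<dots> = bayes_inner whole (bayes_bigadd ?K w) f"
        by (rule whole.bayes_inner_cong_left[OF gB fB bigB eq])
      also have "\<dots> = (\<Sum>k\<in>?K. bayes_inner whole (w k) f)"
        by (rule whole.bayes_inner_bigadd_left[OF fin wB fB])
      also have "\<dots> = 0"
      proof (rule sum.neutral, rule ballI)
        fix k assume k: "k \<in> ?K"
        then have "k \<subseteq> D" "k \<noteq> I" using I by auto
        then have "bayes_orthogonal whole (pure_space k) (pure_space I)"
          using I by (intro pure_spaces_orthogonal)
        then show "bayes_inner whole (w k) f = 0"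
          using w k fp unfolding bayes_orthogonal_def by blast
      qed
      finally show "bayes_inner whole f g = 0" .
    qed
  qed
qed

lemma component_space_eq_pure_space:
  assumes "I \<subseteq> D" "I \<noteq> {}"
  shows "component_space M D I = pure_space I"
proof -
  have "finite I" using assms(1) finite_D by (rule finite_subset)
  then show ?thesis using assms
  proof (induction I rule: finite_psubset_induct)
    case (psubset I)
    show ?case
    proof (cases "card I = 1")
      case True
      then obtain i where "I = {i}" by (auto simp: card_1_singleton_iff)
      then have "{J. J \<noteq> {} \<and> J \<subset> I} = {}" by auto
      then have "pure_space I = B2_on M D I" unfolding set_eq_iff pure_space_iff by blast
      then show ?thesis using True by (simp add: component_space_def)
    next
      case False
      moreover have "card I \<noteq> 0" using psubset.hyps psubset.prems(2) by simp
      ultimately have card: "\<not> card I < 2" by linarith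
      have "bayes_sum_space whole {J. J \<noteq> {} \<and> J \<subset> I}
            (\<lambda>J. if card J = 1 then B2_on M D J else interaction_space M D J) =
          bayes_sum_space whole {J. J \<noteq> {} \<and> J \<subset> I} pure_space"
      proof (rule bayes_sum_space_cong[OF refl refl])
        fix J assume "J \<in> {J. J \<noteq> {} \<and> J \<subset> I}"
        then show "(if card J = 1 then B2_on M D J else interaction_space M D J) = pure_space J"
          using psubset.IH[of J] psubset.prems(1) by (auto simp: component_space_def)
      qed
      then have "interaction_space M D I =
          {f \<in> B2_on M D I. \<forall>g\<in>bayes_sum_space whole {J. J \<noteq> {} \<and> J \<subset> I} pure_space.
             bayes_inner whole f g = 0}"
        by (subst interaction_space.simps) (simp only: card if_False)
      also have "\<dots> = pure_space I"
        using orthogonal_to_pure_sum_iff[OF psubset.prems(1)] pure_space_B2_on by blast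
      finally show ?thesis using False by (simp add: component_space_def)
    qed
  qed
qed

lemma interaction_space_eq_pure_space:
  assumes I: "I \<subseteq> D" "2 \<le> card I"
  shows "interaction_space M D I = pure_space I"
proof -
  have "I \<noteq> {}" using I(2) by auto
  then show ?thesis
    using component_space_eq_pure_space[OF I(1)] I(2) by (simp add: component_space_def)
qed

lemma bayes_subspace_interaction_space:
  "I \<subseteq> D \<Longrightarrow> 2 \<le> card I \<Longrightarrow> bayes_subspace whole (interaction_space M D I)"
  by (simp add: interaction_space_eq_pure_space bayes_subspace_pure_space)

lemma component_spaces_orthogonal:
  assumes "I \<subseteq> D" "J \<subseteq> D" "I \<noteq> {}" "J \<noteq> {}" "I \<noteq> J"
  shows "bayes_orthogonal whole (component_space M D I) (component_space M D J)"
  using assms by (simp add: component_space_eq_pure_space pure_spaces_orthogonal)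

text \<open>
  Expand \<open>f\<close> into its interaction parts: all except the \<open>I\<close>-th lie in pure spaces orthogonal to
  \<open>pure_space I\<close>.
\<close>

lemma interaction_part_is_pure_projection:
  assumes f: "f \<in> B2 whole" and I: "I \<subseteq> D" "I \<noteq> {}"
  shows "is_bayes_projection whole (pure_space I) f (interaction_part M D f I)"
  unfolding is_bayes_projection_def
proof (intro conjI ballI)
  show "interaction_part M D f I \<in> pure_space I"
    by (rule interaction_part_in_pure_space[OF f I(1)])
  fix g assume g: "g \<in> pure_space I"
  note gB = pure_space_B2[OF g]
  let ?N = "{J. J \<noteq> {} \<and> J \<subseteq> D}"
  have D: "D \<noteq> {}" using I by auto
  note fin = finite_nonempty_subsets[OF order_refl]
  have partB: "interaction_part M D f J \<in> B2 whole" if "J \<in> ?N" for J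
    using that by (intro interaction_part_B2 f) auto
  have "bayes_inner whole f g = bayes_inner whole (bayes_bigadd ?N (interaction_part M D f)) g"
    using f by (intro whole.bayes_inner_cong_left gB whole.bayes_bigadd_B2 fin partB
        B2_on_eq_bigadd_interaction_parts[OF _ order_refl D]) (auto simp: B2_on_whole)
  also have "\<dots> = (\<Sum>J\<in>?N. bayes_inner whole (interaction_part M D f J) g)"
    by (rule whole.bayes_inner_bigadd_left[OF fin partB gB])
  also have "\<dots> = (\<Sum>J\<in>?N. if J = I then bayes_inner whole (interaction_part M D f I) g else 0)"
  proof (rule sum.cong[OF refl])
    fix J assume "J \<in> ?N"
    then show "bayes_inner whole (interaction_part M D f J) g =
        (if J = I then bayes_inner whole (interaction_part M D f I) g else 0)"
      using pure_spaces_orthogonal[of J I] interaction_part_in_pure_space[OF f, of J] g I(1)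
      by (auto simp: bayes_orthogonal_def)
  qed
  also have "\<dots> = bayes_inner whole (interaction_part M D f I) g"
    using I fin by simp
  finally show "bayes_inner whole (bayes_diff f (interaction_part M D f I)) g = 0"
    by (simp add: whole.bayes_inner_diff_left f interaction_part_B2 I gB)
qed

lemma interaction_part_is_projection:
  assumes f: "f \<in> B2 whole" and I: "I \<subseteq> D" "2 \<le> card I"
  shows "is_bayes_projection whole (interaction_space M D I) f (interaction_part M D f I)"
proof -
  have "I \<noteq> {}" using I(2) by auto
  then show ?thesis
    unfolding interaction_space_eq_pure_space[OF I]
    by (rule interaction_part_is_pure_projection[OF f I(1)])
qed

lemma B2_eq_sum_pure_spaces:
  assumes D: "D \<noteq> {}"
  shows "B2 whole = bayes_sum_space whole {I. I \<noteq> {} \<and> I \<subseteq> D} pure_space"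
proof
  let ?N = "{I. I \<noteq> {} \<and> I \<subseteq> D}"
  show "B2 whole \<subseteq> bayes_sum_space whole ?N pure_space"
  proof
    fix f assume f: "f \<in> B2 whole"
    have "\<forall>I\<in>?N. interaction_part M D f I \<in> pure_space I"
      using interaction_part_in_pure_space[OF f] by blast
    moreover have "bayes_eq whole f (bayes_bigadd ?N (interaction_part M D f))"
      by (rule B2_on_eq_bigadd_interaction_parts[OF _ order_refl D]) (simp add: B2_on_whole f)
    ultimately show "f \<in> bayes_sum_space whole ?N pure_space"
      unfolding bayes_sum_space_def using whole.B2_bayes[OF f] by blast
  qed
  show "bayes_sum_space whole ?N pure_space \<subseteq> B2 whole"
  proof
    fix f assume "f \<in> bayes_sum_space whole ?N pure_space"
    then obtain w where f: "f \<in> bayes whole" and w: "\<forall>I\<in>?N. w I \<in> pure_space I"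
      and eq: "bayes_eq whole f (bayes_bigadd ?N w)"
      unfolding bayes_sum_space_def by blast
    have bigB: "bayes_bigadd ?N w \<in> B2 whole"
      by (rule whole.bayes_bigadd_B2[OF finite_nonempty_subsets[OF order_refl]]) (use w pure_space_B2 in blast)
    show "f \<in> B2 whole"
      by (rule whole.bayes_eq_B2[OF bigB bayes_measurable[OF f] eq])
  qed
qed

lemma direct_sum_component_spaces:
  assumes D: "D \<noteq> {}"
  shows "bayes_direct_sum whole (B2 whole) {I. I \<noteq> {} \<and> I \<subseteq> D} (component_space M D)"
  unfolding bayes_direct_sum_def
proof (intro conjI allI impI ballI)
  let ?N = "{I. I \<noteq> {} \<and> I \<subseteq> D}" and ?W = "component_space M D"
  have W: "?W I = pure_space I" if "I \<in> ?N" for I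
    using that by (simp add: component_space_eq_pure_space)
  have sub: "bayes_subspace whole (?W I)" if "I \<in> ?N" for I
    using W[OF that] that by (simp add: bayes_subspace_pure_space)
  then show "bayes_subspace whole (?W I)" if "I \<in> ?N" for I
    using that .
  have "bayes_sum_space whole ?N ?W = bayes_sum_space whole ?N pure_space"
    by (rule bayes_sum_space_cong[OF refl refl W])
  then show "B2 whole = bayes_sum_space whole ?N ?W"
    using B2_eq_sum_pure_spaces[OF D] by simp
  fix w w' I
  assume w: "(\<forall>k\<in>?N. w k \<in> ?W k \<and> w' k \<in> ?W k) \<and>
      bayes_eq whole (bayes_bigadd ?N w) (bayes_bigadd ?N w')" and I: "I \<in> ?N"
  show "bayes_eq whole (w I) (w' I)"
  proof (rule whole.orthogonal_bigadd_unique[OF finite_nonempty_subsets[OF order_refl] sub])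
    show "bayes_orthogonal whole (?W J) (?W K)" if "J \<in> ?N" "K \<in> ?N" "J \<noteq> K" for J K
      using that by (simp add: component_spaces_orthogonal)
  qed (use w I in simp_all)
qed

end


theorem theorem4p2:
  fixes d :: nat and M :: "nat \<Rightarrow> 'a measure"
  assumes "2 \<le> d"
    and "\<And>i. i \<in> {1..d} \<Longrightarrow> finite_measure (M i)"
    and "\<And>i. i \<in> {1..d} \<Longrightarrow> emeasure (M i) (space (M i)) \<noteq> 0"
  shows "(\<forall>f \<in> B2 (Pi\<^sub>M {1..d} M). \<forall>I. I \<subseteq> {1..d} \<and> 2 \<le> card I \<longrightarrow>
            is_bayes_projection (Pi\<^sub>M {1..d} M) (interaction_space M {1..d} I) f
              (interaction_part M {1..d} f I) \<and>
            (\<forall>p. is_bayes_projection (Pi\<^sub>M {1..d} M) (interaction_space M {1..d} I) f p \<longrightarrow>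
                 bayes_eq (Pi\<^sub>M {1..d} M) p (interaction_part M {1..d} f I)))
       \<and> bayes_direct_sum (Pi\<^sub>M {1..d} M) (B2 (Pi\<^sub>M {1..d} M))
            {I. I \<noteq> {} \<and> I \<subseteq> {1..d}} (component_space M {1..d})
       \<and> (\<forall>I J. I \<noteq> {} \<and> I \<subseteq> {1..d} \<and> J \<noteq> {} \<and> J \<subseteq> {1..d} \<and> I \<noteq> J \<longrightarrow>
            bayes_orthogonal (Pi\<^sub>M {1..d} M) (component_space M {1..d} I)
              (component_space M {1..d} J))"
proof -
  interpret reference_product M "{1..d}"
    by (rule reference_product.intro[OF finite_atLeastAtMost assms(2,3)])
  have D: "{1..d} \<noteq> {}" using assms(1) by simp
  show ?thesis
  proof (intro conjI ballI allI impI)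
    fix f I assume f: "f \<in> B2 (Pi\<^sub>M {1..d} M)" and "I \<subseteq> {1..d} \<and> 2 \<le> card I"
    then have I: "I \<subseteq> {1..d}" "2 \<le> card I" by blast+
    show "is_bayes_projection (Pi\<^sub>M {1..d} M) (interaction_space M {1..d} I) f
        (interaction_part M {1..d} f I)"
      by (rule interaction_part_is_projection[OF f I])
    fix p assume "is_bayes_projection (Pi\<^sub>M {1..d} M) (interaction_space M {1..d} I) f p"
    then show "bayes_eq (Pi\<^sub>M {1..d} M) p (interaction_part M {1..d} f I)"
      by (rule whole.bayes_projection_unique[OF bayes_subspace_interaction_space[OF I] f _
            interaction_part_is_projection[OF f I]])
  next
    show "bayes_direct_sum (Pi\<^sub>M {1..d} M) (B2 (Pi\<^sub>M {1..d} M))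
        {I. I \<noteq> {} \<and> I \<subseteq> {1..d}} (component_space M {1..d})"
      by (rule direct_sum_component_spaces[OF D])
  next
    fix I J assume "I \<noteq> {} \<and> I \<subseteq> {1..d} \<and> J \<noteq> {} \<and> J \<subseteq> {1..d} \<and> I \<noteq> J"
    then show "bayes_orthogonal (Pi\<^sub>M {1..d} M) (component_space M {1..d} I) (component_space M {1..d} J)"
      by (intro component_spaces_orthogonal) blast+
  qed
qed

end
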